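(* Let $s>0$ belong to $\mathbb T$. For $F\in\mathbb T$, let $\mathrm{tr}_{\succ s}F$ be the series obtained from the Hahn expansion of $F$ by retaining precisely the terms whose support monomials $m$ have $m/s$ infinite. This operation is linear and weakly increasing, and maps $K$ into $K$ and $\mathcal H$ into $\mathcal H$. Moreover, for $F,F'\in\mathbb T$, $$F-\mathrm{tr}_{\succ s}F=O(s),\qquad \mathrm{tr}_{\succ s}F=\mathrm{tr}_{\succ s}F'\iff F-F'=O(s).$$ If $s\in\mathfrak M$, then $$F=\mathrm{tr}_{\succ s}F+\mathrm{coef}_s(F)\,s+o(s).$$ For $h\in\mathfrak M$ there is also the identity $$\mathrm{tr}_{\succ hs}(hF)=h\,\mathrm{tr}_{\succ s}F.$$
   Context: $\mathbb T$ is the standard ordered exponential field of well-based logarithmic-exponential series over $\mathbb R$ (van den Dries–Macintyre–Marker), with positive infinite formal variable $x$. It is an elementary extension of $\mathbb R_{\exp}$. $\mathbb T$ has an ordered multiplicative monomial group $\mathfrak M$, containing $x$ and $\log x$, and every element of $\mathbb T$ has a unique Hahn expansion with real coefficients and reverse-well-ordered support in $\mathfrak M$; distinct monomials lie in distinct Archimedean classes. With $y=\log x$ there are increasing monomial groups $\mathfrak M_h(y)\subseteq\mathfrak M$ ($h\ge0$), $\mathfrak M_0(y)=y^{\mathbb R}$, such that the full Hahn fields $T_h(y)=\mathbb R((\mathfrak M_h(y)))$ are contained in $\mathbb T$ and $\exp(T_h(y)^{\uparrow})\subseteq\mathfrak M_{h+1}(y)$. Restricting the support of an element of such a finite level gives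 again an element of that level. $\mathrm{coef}_s(F)$ is the real coefficient of the monomial $s$ in $F$. For $u,v\in\mathbb T$, $v\ne0$: $u=O(v)$ means $|u|\le C|v|$ for some real $C>0$; $u=o(v)$ means $|u|<\epsilon|v|$ for every real $\epsilon>0$. An element is infinite if its absolute value exceeds every real number. For an additive space $V$ of series, $V^{\uparrow}$ is the subspace of series supported strictly above the monomial $1$ (including $0$). Define recursively inside $\mathbb T$ $$G_0=x^{\mathbb Z},\quad K_n=\mathbb R((G_n)),\quad G_{n+1}=\{\exp(\gamma)\,x^{\vartheta+k}:\gamma,\vartheta\in K_n^{\uparrow},\ k\in\mathbb Z\},\quad G=\bigcup_{n\ge0}G_n,\quad K=\bigcup_{n\ge0}K_n,$$ where $\mathbb R((G_n))$ is the set of all Hahn series with real coefficients and reverse-well-ordered support in $G_n$ (these lie in $\mathbb T$, since $G_n\subseteq\mathfrak M_{n+1}(y)$). Put $\mathcal H=K+K\log x$. *)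

theory Defs
  imports Complex_Main "HOL-Library.Countable_Set_Type"
begin


text \<open>The field \<open>T\<close> of well-based logarithmic-exponential series is constructed as follows.  With
\<open>l\<^sub>0 = x\<close> and \<open>l\<^sub>k\<^sub>+\<^sub>1 = log l\<^sub>k\<close>, the logarithm is a bijection from the monomials of \<open>T\<close> onto the
purely infinite series.  So a monomial is either some \<open>l\<^sub>k\<close> (encoded by \<open>Lg k\<close>), or the exponential
of a purely infinite series different from all \<open>l\<^sub>k\<^sub>+\<^sub>1\<close> (encoded by \<open>ExpS c\<close>, where \<open>c\<close> is the graph of
the coefficient function on the support).  \<open>plog\<close> and \<open>pexp\<close> pass between a monomial and its logarithm.

Storing only countably many terms is no restriction: lemma \<open>countable_hahn\<close> below shows that
every series with reverse-well-ordered support in one of the levels has countable support.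
Only the elements of \<open>mons\<close> below are actual monomials; other elements of \<open>pmono\<close> are junk.\<close>

datatype pmono = Lg nat | ExpS "(pmono \<times> real) cset"

definition supp :: "('a \<Rightarrow> real) \<Rightarrow> 'a set" where
  "supp f = {p. f p \<noteq> 0}"

definition single :: "'a \<Rightarrow> 'a \<Rightarrow> real" where
  "single p = (\<lambda>q. if q = p then 1 else 0)"

primrec plog :: "pmono \<Rightarrow> pmono \<Rightarrow> real" where
  "plog (Lg k) = single (Lg (Suc k))"
| "plog (ExpS c) = (\<lambda>p. if \<exists>r. (p, r) \<in> rcset c then THE r. (p, r) \<in> rcset c else 0)"

definition pexp :: "(pmono \<Rightarrow> real) \<Rightarrow> pmono" where
  "pexp f = (if \<exists>k. f = single (Lg (Suc k)) then Lg (THE k. f = single (Lg (Suc k)))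
             else ExpS (acset {(p, f p) | p. f p \<noteq> 0}))"

text \<open>The order of the monomials: \<open>m < n\<close> iff \<open>log n - log m\<close> has a positive leading coefficient.  As
\<open>log l\<^sub>k = l\<^sub>k\<^sub>+\<^sub>1\<close>, this leaves the order of the \<open>l\<^sub>k\<close> to be fixed, which rule \<open>atom\<close> does.\<close>

inductive pless :: "pmono \<Rightarrow> pmono \<Rightarrow> bool" where
  atom: "j < i \<Longrightarrow> pless (Lg i) (Lg j)"
| step: "plog n p - plog m p > 0 \<Longrightarrow>
         (\<And>q. q \<noteq> p \<Longrightarrow> plog n q - plog m q \<noteq> 0 \<Longrightarrow> pless q p) \<Longrightarrow> pless m n"

definition wo :: "('a \<Rightarrow> 'a \<Rightarrow> bool) \<Rightarrow> 'a set \<Rightarrow> bool" where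
  "wo R X \<longleftrightarrow> (\<forall>Y\<subseteq>X. Y \<noteq> {} \<longrightarrow> (\<exists>y\<in>Y. \<forall>z\<in>Y. z \<noteq> y \<longrightarrow> R y z))"

abbreviation rwo :: "('a \<Rightarrow> 'a \<Rightarrow> bool) \<Rightarrow> 'a set \<Rightarrow> bool" where
  "rwo R \<equiv> wo (\<lambda>x y. R y x)"

text \<open>\<open>hahn S\<close> is the set of all Hahn series over \<open>S\<close>, and \<open>hahn_up S\<close> the subset of those supported
strictly above the monomial \<open>1 = exp 0\<close>.\<close>

definition hahn :: "pmono set \<Rightarrow> (pmono \<Rightarrow> real) set" where
  "hahn S = {f. supp f \<subseteq> S \<and> rwo pless (supp f)}"

definition hahn_up :: "pmono set \<Rightarrow> (pmono \<Rightarrow> real) set" where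
  "hahn_up S = {f \<in> hahn S. \<forall>p\<in>supp f. pless (pexp (\<lambda>_. 0)) p}"

text \<open>\<open>level k h\<close> is the monomial group \<open>M\<^sub>h(l\<^sub>k)\<close>: \<open>M\<^sub>0(l\<^sub>k)\<close> consists of the real powers of \<open>l\<^sub>k\<close>, and
\<open>M\<^sub>h\<^sub>+\<^sub>1(l\<^sub>k)\<close> of the products \<open>l\<^sub>k\<^sup>r exp(\<gamma>)\<close> with \<open>\<gamma>\<close> a purely infinite Hahn series over \<open>M\<^sub>h(l\<^sub>k)\<close>.
The real power \<open>l\<^sub>k\<^sup>r\<close> is \<open>exp(r l\<^sub>k\<^sub>+\<^sub>1)\<close>.  These are the levels of the exponential closure of
\<open>R((l\<^sub>k\<^sup>R))\<close>; the substitution \<open>l\<^sub>k = exp l\<^sub>k\<^sub>+\<^sub>1\<close> embeds level \<open>h\<close> for \<open>k\<close> into level \<open>h + 1\<close> for \<open>k + 1\<close>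
(lemma \<open>level_lift\<close>).\<close>

fun level :: "nat \<Rightarrow> nat \<Rightarrow> pmono set" where
  "level k 0 = {pexp (\<lambda>p. r * single (Lg (Suc k)) p) | r. True}"
| "level k (Suc h) = {pexp (\<lambda>p. r * single (Lg (Suc k)) p + \<gamma> p) | r \<gamma>. \<gamma> \<in> hahn_up (level k h)}"

lemma single_simps [simp]: "single p p = 1" "q \<noteq> p \<Longrightarrow> single p q = 0"
  by (auto simp: single_def)

lemma single_inj [simp]: "single p = single q \<longleftrightarrow> p = q"
  by (auto simp: single_def fun_eq_iff split: if_splits)

lemma supp_single [simp]: "supp (single p) = {p}"
  by (auto simp: supp_def single_def)

lemma plog_pexp:
  assumes "countable (supp f)"
  shows "plog (pexp f) = f"
proof (cases "\<exists>k. f = single (Lg (Suc k))")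
  case True
  then show ?thesis by (auto simp: pexp_def)
next
  case False
  have "{(p, f p) | p. f p \<noteq> 0} = (\<lambda>p. (p, f p)) ` supp f" by (auto simp: supp_def)
  then have "countable {(p, f p) | p. f p \<noteq> 0}" using assms by simp
  then have "rcset (acset {(p, f p) | p. f p \<noteq> 0}) = {(p, f p) | p. f p \<noteq> 0}" by simp
  then show ?thesis using False by (auto simp: pexp_def fun_eq_iff)
qed

definition pos :: "('a \<Rightarrow> 'a \<Rightarrow> bool) \<Rightarrow> ('a \<Rightarrow> real) \<Rightarrow> bool" where
  "pos R f \<longleftrightarrow> (\<exists>p. f p > 0 \<and> (\<forall>q. q \<noteq> p \<longrightarrow> f q \<noteq> 0 \<longrightarrow> R q p))"

lemma pless_iff: "pless m n \<longleftrightarrow> pos pless (\<lambda>q. plog n q - plog m q)"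
proof
  assume "pless m n"
  then show "pos pless (\<lambda>q. plog n q - plog m q)"
  proof cases
    case (atom j i)
    then show ?thesis
      unfolding pos_def
      by (intro exI[of _ "Lg (Suc j)"]) (auto simp: single_def intro: pless.atom)
  next
    case (step p)
    then show ?thesis unfolding pos_def by blast
  qed
next
  assume "pos pless (\<lambda>q. plog n q - plog m q)"
  then show "pless m n" unfolding pos_def by (blast intro: pless.step)
qed

definition lin :: "('a \<Rightarrow> 'a \<Rightarrow> bool) \<Rightarrow> 'a set \<Rightarrow> bool" where
  "lin R V \<longleftrightarrow> (\<forall>x\<in>V. \<not> R x x) \<and> (\<forall>x\<in>V. \<forall>y\<in>V. \<forall>z\<in>V. R x y \<longrightarrow> R y z \<longrightarrow> R x z)
     \<and> (\<forall>x\<in>V. \<forall>y\<in>V. x = y \<or> R x y \<or> R y x)"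

lemma linD:
  assumes "lin R V"
  shows "x \<in> V \<Longrightarrow> \<not> R x x"
    and "x \<in> V \<Longrightarrow> y \<in> V \<Longrightarrow> z \<in> V \<Longrightarrow> R x y \<Longrightarrow> R y z \<Longrightarrow> R x z"
    and "x \<in> V \<Longrightarrow> y \<in> V \<Longrightarrow> x = y \<or> R x y \<or> R y x"
    and "x \<in> V \<Longrightarrow> y \<in> V \<Longrightarrow> R x y \<Longrightarrow> \<not> R y x"
  using assms unfolding lin_def by blast+

lemma lin_subset: "lin R V \<Longrightarrow> W \<subseteq> V \<Longrightarrow> lin R W"
  unfolding lin_def by blast

lemma wo_subset: "wo R X \<Longrightarrow> Y \<subseteq> X \<Longrightarrow> wo R Y"
  unfolding wo_def by (meson subset_trans)

lemma pos_asym: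
  assumes "lin R V" "supp f \<subseteq> V" "pos R f"
  shows "\<not> pos R (\<lambda>q. - f q)"
proof
  assume "pos R (\<lambda>q. - f q)"
  then obtain p where p: "- f p > 0" "\<And>q. q \<noteq> p \<Longrightarrow> - f q \<noteq> 0 \<Longrightarrow> R q p"
    unfolding pos_def by blast
  obtain p' where p': "f p' > 0" "\<And>q. q \<noteq> p' \<Longrightarrow> f q \<noteq> 0 \<Longrightarrow> R q p'"
    using assms(3) unfolding pos_def by blast
  have "p \<noteq> p'" "p \<in> V" "p' \<in> V" using p p' assms(2) by (auto simp: supp_def)
  moreover have "R p' p" "R p p'" using p p' \<open>p \<noteq> p'\<close> by auto
  ultimately show False using linD(4)[OF assms(1)] by blast
qed

lemma pos_add:
  assumes "lin R V" "supp f \<subseteq> V" "supp g \<subseteq> V" "pos R f" "pos R g"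
  shows "pos R (\<lambda>q. f q + g q)"
proof -
  obtain p where p: "f p > 0" "\<And>q. q \<noteq> p \<Longrightarrow> f q \<noteq> 0 \<Longrightarrow> R q p"
    using assms(4) unfolding pos_def by blast
  obtain p' where p': "g p' > 0" "\<And>q. q \<noteq> p' \<Longrightarrow> g q \<noteq> 0 \<Longrightarrow> R q p'"
    using assms(5) unfolding pos_def by blast
  have V: "p \<in> V" "p' \<in> V" using p p' assms by (auto simp: supp_def)
  have fV: "\<And>q. f q \<noteq> 0 \<Longrightarrow> q \<in> V" and gV: "\<And>q. g q \<noteq> 0 \<Longrightarrow> q \<in> V"
    using assms by (auto simp: supp_def)
  consider "p = p'" | "R p p'" | "R p' p" using linD(3)[OF assms(1) V] by blast
  then show ?thesis
  proof cases
    case 1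
    have "f p + g p > 0" using p(1) p'(1) 1 by simp
    moreover have "R q p" if "q \<noteq> p" "f q + g q \<noteq> 0" for q
    proof (cases "f q = 0")
      case True
      then show ?thesis using p'(2)[of q] that 1 by auto
    next
      case False
      then show ?thesis using p(2)[of q] that by auto
    qed
    ultimately show ?thesis unfolding pos_def by blast
  next
    case 2
    then have ne: "p \<noteq> p'" using linD(1)[OF assms(1)] V by blast
    have f0: "f p' = 0" using p(2)[of p'] 2 linD(4)[OF assms(1) V] ne by auto
    have "R q p'" if "q \<noteq> p'" "f q + g q \<noteq> 0" for q
    proof (cases "g q = 0")
      case True
      then have "f q \<noteq> 0" using that by auto
      then show ?thesis using p(2)[of q] 2 linD(2)[OF assms(1) fV[of q] V] by blast
    next
      case False
      then show ?thesis using p' that by blast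
    qed
    then show ?thesis unfolding pos_def using f0 p' by (intro exI[of _ p']) auto
  next
    case 3
    then have ne: "p \<noteq> p'" using linD(1)[OF assms(1)] V by blast
    have f0: "g p = 0" using p'(2)[of p] 3 linD(4)[OF assms(1) V] ne by auto
    have "R q p" if "q \<noteq> p" "f q + g q \<noteq> 0" for q
    proof (cases "f q = 0")
      case True
      then have "g q \<noteq> 0" using that by auto
      then show ?thesis using p'(2)[of q] 3 linD(2)[OF assms(1) gV[of q] V(2,1)] by blast
    next
      case False
      then show ?thesis using p that by blast
    qed
    then show ?thesis unfolding pos_def using f0 p by (intro exI[of _ p]) auto
  qed
qed

lemma pos_total:
  assumes "rwo R (supp f)" "f \<noteq> (\<lambda>_. 0)"
  shows "pos R f \<or> pos R (\<lambda>q. - f q)"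
proof -
  have "supp f \<noteq> {}" using assms(2) by (auto simp: supp_def)
  then obtain p where p: "p \<in> supp f" "\<And>q. q \<in> supp f \<Longrightarrow> q \<noteq> p \<Longrightarrow> R q p"
    using assms(1)[unfolded wo_def, rule_format, of "supp f"] by blast
  then have "f p > 0 \<or> - f p > 0" by (auto simp: supp_def)
  then show ?thesis using p unfolding pos_def supp_def by auto
qed

lemma rwo_Un:
  assumes "lin R V" "A \<subseteq> V" "B \<subseteq> V" "rwo R A" "rwo R B"
  shows "rwo R (A \<union> B)"
  unfolding wo_def
proof (intro allI impI)
  fix Y assume Y: "Y \<subseteq> A \<union> B" "Y \<noteq> {}"
  show "\<exists>y\<in>Y. \<forall>z\<in>Y. z \<noteq> y \<longrightarrow> R z y"
  proof (cases "Y \<inter> A = {} \<or> Y \<inter> B = {}")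
    case True
    then have "Y \<subseteq> A \<or> Y \<subseteq> B" using Y by blast
    then show ?thesis using assms(4,5) Y(2) unfolding wo_def by blast
  next
    case False
    then obtain a where a: "a \<in> Y \<inter> A" "\<And>z. z \<in> Y \<inter> A \<Longrightarrow> z \<noteq> a \<Longrightarrow> R z a"
      using assms(4)[unfolded wo_def, rule_format, of "Y \<inter> A"] by blast
    obtain b where b: "b \<in> Y \<inter> B" "\<And>z. z \<in> Y \<inter> B \<Longrightarrow> z \<noteq> b \<Longrightarrow> R z b"
      using False assms(5)[unfolded wo_def, rule_format, of "Y \<inter> B"] by blast
    have V: "a \<in> V" "b \<in> V" using a b assms by auto
    consider "a = b" | "R a b" | "R b a" using linD(3)[OF assms(1) V] by blast
    then show ?thesis
    proof cases
      case 1
      then show ?thesis using a b Y by blast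
    next
      case 2
      have "R z b" if "z \<in> Y" "z \<noteq> b" for z
      proof (cases "z \<in> B")
        case True
        then show ?thesis using b that by blast
      next
        case False
        then have "z \<in> Y \<inter> A" using that Y by blast
        then show ?thesis using a 2 linD(2)[OF assms(1) _ V, of z] assms(2) by blast
      qed
      then show ?thesis using b by blast
    next
      case 3
      have "R z a" if "z \<in> Y" "z \<noteq> a" for z
      proof (cases "z \<in> A")
        case True
        then show ?thesis using a that by blast
      next
        case False
        then have "z \<in> Y \<inter> B" using that Y by blast
        then show ?thesis using b 3 linD(2)[OF assms(1) _ V(2,1), of z] assms(3) by blast
      qed
      then show ?thesis using a by blast
    qed
  qed
qed

lemma supp_diff: "supp (\<lambda>q. f q - g q) \<subseteq> supp f \<union> supp g"
  by (auto simp: supp_def)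

lemma supp_add: "supp (\<lambda>q. f q + g q) \<subseteq> supp f \<union> supp g"
  by (auto simp: supp_def)

lemma rwo_diff:
  assumes "lin R V" "supp f \<subseteq> V" "supp g \<subseteq> V" "rwo R (supp f)" "rwo R (supp g)"
  shows "rwo R (supp (\<lambda>q. f q - g q))"
  using wo_subset[OF rwo_Un[OF assms] supp_diff] .

text \<open>The lexicographic order on series over a linearly ordered set is linear.\<close>

abbreviation sless :: "('a \<Rightarrow> 'a \<Rightarrow> bool) \<Rightarrow> ('a \<Rightarrow> real) \<Rightarrow> ('a \<Rightarrow> real) \<Rightarrow> bool" where
  "sless R f g \<equiv> pos R (\<lambda>q. g q - f q)"

lemma lin_sless:
  assumes "lin R V" "\<And>f. f \<in> A \<Longrightarrow> supp f \<subseteq> V \<and> rwo R (supp f)"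
  shows "lin (sless R) A"
  unfolding lin_def
proof (intro conjI ballI impI)
  show "\<not> sless R f f" for f by (simp add: pos_def)
next
  fix f g h assume A: "f \<in> A" "g \<in> A" "h \<in> A" and lt: "sless R f g" "sless R g h"
  have "supp (\<lambda>q. g q - f q) \<subseteq> V" "supp (\<lambda>q. h q - g q) \<subseteq> V"
    using assms(2)[OF A(1)] assms(2)[OF A(2)] assms(2)[OF A(3)] 
    by (auto intro!: subset_trans[OF supp_diff])
  then have "pos R (\<lambda>q. (g q - f q) + (h q - g q))"
    by (rule pos_add[OF assms(1) _ _ lt])
  then show "sless R f h" by simp
next
  fix f g assume A: "f \<in> A" "g \<in> A"
  have "rwo R (supp (\<lambda>q. g q - f q))"
    by (rule rwo_diff[OF assms(1)]) (use assms(2) A in auto)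
  then have "(\<lambda>q. g q - f q) = (\<lambda>_. 0) \<or> sless R f g \<or> sless R g f"
    using pos_total[of R "\<lambda>q. g q - f q"] by auto
  then show "f = g \<or> sless R f g \<or> sless R g f" by (auto simp: fun_eq_iff)
qed

lemma lin_step:
  assumes "lin pless V" "inj_on plog W" "\<And>m. m \<in> W \<Longrightarrow> supp (plog m) \<subseteq> V \<and> rwo pless (supp (plog m))"
  shows "lin pless W"
proof -
  have L: "lin (sless pless) (plog ` W)"
    by (rule lin_sless[OF assms(1)]) (use assms(3) in blast)
  show ?thesis unfolding lin_def
  proof (intro conjI ballI impI)
    fix x assume "x \<in> W"
    then show "\<not> pless x x" unfolding pless_iff[of x x] using linD(1)[OF L] by blast
  next
    fix x y z assume "x \<in> W" "y \<in> W" "z \<in> W" "pless x y" "pless y z"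
    then show "pless x z" using linD(2)[OF L, of "plog x" "plog y" "plog z"]
      unfolding pless_iff[of x y] pless_iff[of y z] pless_iff[of x z] by blast
  next
    fix x y assume "x \<in> W" "y \<in> W"
    then show "x = y \<or> pless x y \<or> pless y x"
      using linD(3)[OF L, of "plog x" "plog y"] inj_onD[OF assms(2), of x y]
      unfolding pless_iff[of x y] pless_iff[of y x] by blast
  qed
qed

lemma countable_wo_real:
  fixes X :: "real set"
  assumes "wo (<) X"
  shows "countable X"
proof -
  define Z where "Z = {x\<in>X. \<exists>y\<in>X. x < y}"
  have "\<exists>s. s \<in> X \<and> x < s \<and> (\<forall>y\<in>X. x < y \<longrightarrow> s \<le> y)" if "x \<in> Z" for x
  proof -
    have "{y\<in>X. x < y} \<subseteq> X" "{y\<in>X. x < y} \<noteq> {}" using that unfolding Z_def by auto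
    then obtain s where "s \<in> {y\<in>X. x < y}" "\<forall>z\<in>{y\<in>X. x < y}. z \<noteq> s \<longrightarrow> s < z"
      using assms unfolding wo_def by blast
    then show ?thesis by force
  qed
  then obtain s where s: "\<And>x. x \<in> Z \<Longrightarrow> s x \<in> X \<and> x < s x \<and> (\<forall>y\<in>X. x < y \<longrightarrow> s x \<le> y)"
    by metis
  have "\<exists>q. x < of_rat q \<and> of_rat q < s x" if "x \<in> Z" for x
    using s[OF that] of_rat_dense[of x "s x"] by blast
  then obtain q where q: "\<And>x. x \<in> Z \<Longrightarrow> x < of_rat (q x) \<and> of_rat (q x) < s x" by metis
  have "inj_on q Z"
  proof (rule linorder_inj_onI)
    fix x y assume "x < y" "x \<in> Z" "y \<in> Z"
    then have "s x \<le> y" using s unfolding Z_def by blast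
    then have "(of_rat (q x)::real) < of_rat (q y)" using q \<open>x\<in>Z\<close> \<open>y\<in>Z\<close> by (meson less_le_trans less_trans)
    then show "q x \<noteq> q y" by auto
  qed auto
  then have Z: "countable Z" by (rule countable_image_inj_on[rotated]) auto
  have "X - Z \<subseteq> {x}" if "x \<in> X - Z" for x
    using that unfolding Z_def by (auto simp: not_less intro: antisym)
  then have "countable (X - Z)"
    by (metis countable_empty countable_insert countable_subset ex_in_conv)
  then show ?thesis using Z countable_Un[of "X - Z" Z] by (metis Un_Diff_cancel2 Un_upper1 countable_subset)
qed

text \<open>A monotone function on an uncountable well-order with countable initial segments
  is constant up to countably many points, if its range has only countable well-ordered subsets.\<close>

lemma mono_const:
  assumes wo: "wo L B" and unc: "uncountable B" and lin: "lin L B"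
    and init: "\<And>b. b \<in> B \<Longrightarrow> countable {a\<in>B. L a b}"
    and mono: "\<And>f g. f \<in> B \<Longrightarrow> g \<in> B \<Longrightarrow> L f g \<Longrightarrow> \<phi> f = \<phi> g \<or> S (\<phi> f) (\<phi> g)"
    and asym: "\<And>x y. x \<in> \<phi> ` B \<Longrightarrow> y \<in> \<phi> ` B \<Longrightarrow> S x y \<Longrightarrow> \<not> S y x"
    and cnt: "wo S (\<phi> ` B) \<Longrightarrow> countable (\<phi> ` B)"
  obtains c where "c \<in> \<phi> ` B" "countable {f\<in>B. \<phi> f \<noteq> c}"
proof -
  have "wo S (\<phi> ` B)"
    unfolding wo_def
  proof (intro allI impI)
    fix Y assume Y: "Y \<subseteq> \<phi> ` B" "Y \<noteq> {}"
    then have "{f\<in>B. \<phi> f \<in> Y} \<noteq> {}" by blast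
    then obtain f where f: "f \<in> B" "\<phi> f \<in> Y" "\<And>g. g \<in> B \<Longrightarrow> \<phi> g \<in> Y \<Longrightarrow> g \<noteq> f \<Longrightarrow> L f g"
      using wo[unfolded wo_def, rule_format, of "{f\<in>B. \<phi> f \<in> Y}"] by blast
    have "S (\<phi> f) z" if z: "z \<in> Y" "z \<noteq> \<phi> f" for z
    proof -
      obtain g where g: "g \<in> B" "z = \<phi> g" using z Y by blast
      then show ?thesis using mono[OF f(1) g(1)] f(3)[of g] z by auto
    qed
    then show "\<exists>y\<in>Y. \<forall>z\<in>Y. z \<noteq> y \<longrightarrow> S y z" using f by blast
  qed
  then have "countable (\<phi> ` B)" by (rule cnt)
  moreover have "B = (\<Union>c\<in>\<phi> ` B. {f\<in>B. \<phi> f = c})" by blast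
  ultimately obtain c where c: "c \<in> \<phi> ` B" "uncountable {f\<in>B. \<phi> f = c}"
    using unc countable_UN[of "\<phi> ` B" "\<lambda>c. {f\<in>B. \<phi> f = c}"] by metis
  obtain f0 where f0: "f0 \<in> B" "\<phi> f0 = c" using c by blast
  have "L f f0" if f: "f \<in> B" "\<phi> f \<noteq> c" for f
  proof (rule ccontr)
    assume "\<not> L f f0"
    then have "L f0 f" using linD(3)[OF lin f(1) f0(1)] f f0 by auto
    then have S: "S c (\<phi> f)" using mono[OF f0(1) f(1)] f f0 by auto
    have "countable {g\<in>B. L g f}" by (rule init[OF f(1)])
    then obtain g where g: "g \<in> B" "\<phi> g = c" "\<not> L g f"
      using c(2) by (metis (mono_tags, lifting) countable_subset mem_Collect_eq subsetI)
    then have "L f g" using linD(3)[OF lin f(1) g(1)] f by auto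
    then have "S (\<phi> f) c" using mono[OF f(1) g(1)] f g by auto
    then show False using asym[of "\<phi> f" c] S f c(1) by blast
  qed
  then have "{f\<in>B. \<phi> f \<noteq> c} \<subseteq> {a\<in>B. L a f0}" by blast
  then have "countable {f\<in>B. \<phi> f \<noteq> c}" using init[OF f0(1)] countable_subset by blast
  then show ?thesis using that c(1) by blast
qed

lemma uncountable_wo_segment:
  assumes "wo L A" "uncountable A" "lin L A"
  obtains B where "B \<subseteq> A" "uncountable B" "\<And>b. b \<in> B \<Longrightarrow> countable {a\<in>B. L a b}"
proof (cases "\<forall>a\<in>A. countable {b\<in>A. L b a}")
  case True
  then show ?thesis using that[of A] assms by blast
next
  case False
  then have "{a\<in>A. uncountable {b\<in>A. L b a}} \<noteq> {}" by blast
  then have "\<exists>a\<in>{a\<in>A. uncountable {b\<in>A. L b a}}. \<forall>c\<in>{a\<in>A. uncountable {b\<in>A. L b a}}. c \<noteq> a \<longrightarrow> L a c"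
    by (intro assms(1)[unfolded wo_def, rule_format]) auto
  then obtain a where a: "a \<in> A" "uncountable {b\<in>A. L b a}"
    and min: "\<And>c. c \<in> A \<Longrightarrow> uncountable {b\<in>A. L b c} \<Longrightarrow> c \<noteq> a \<Longrightarrow> L a c"
    by auto
  show ?thesis
  proof (rule that[of "{b\<in>A. L b a}"])
    fix b assume b: "b \<in> {b\<in>A. L b a}"
    then have "countable {c\<in>A. L c b}"
      using min[of b] linD(4)[OF assms(3), of b a] linD(1)[OF assms(3) a(1)] a by blast
    then show "countable {c \<in> {b\<in>A. L b a}. L c b}" by (rule countable_subset[rotated]) auto
  qed (use a in auto)
qed

lemma coinitial_rwo:
  obtains C where "C \<subseteq> U" "rwo R C" "\<And>u. u \<in> U \<Longrightarrow> \<exists>c\<in>C. c = u \<or> R c u \<or> \<not> lin R U"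
proof (cases "lin R U")
  case False
  then have "u \<in> U \<Longrightarrow> \<exists>c\<in>(if U = {} then {} else {SOME u. u \<in> U}). c = u \<or> R c u \<or> \<not> lin R U" for u
    by auto
  then show ?thesis
    by (intro that[of "if U = {} then {} else {SOME u. u \<in> U}"])
       (auto simp: wo_def some_in_eq split: if_splits)
next
  case True
  obtain r :: "'a rel" where r: "well_order_on U r" using well_order_on by blast
  then have wfr: "wf (r - Id)" and tot: "total_on U r" and trr: "trans r" and anti: "antisym r"
    unfolding well_order_on_def linear_order_on_def partial_order_on_def preorder_on_def by auto
  define C where "C = {c\<in>U. \<forall>u\<in>U. (u, c) \<in> r - Id \<longrightarrow> R c u}"
  show ?thesis
  proof (rule that[of C])
    show "C \<subseteq> U" unfolding C_def by blast
    show "rwo R C" unfolding wo_def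
    proof (intro allI impI)
      fix Y assume Y: "Y \<subseteq> C" "Y \<noteq> {}"
      then obtain y where y: "y \<in> Y" "\<And>z. (z, y) \<in> r - Id \<Longrightarrow> z \<notin> Y"
        using wfE_min[OF wfr, of _ Y] by (metis ex_in_conv)
      have "R z y" if z: "z \<in> Y" "z \<noteq> y" for z
      proof -
        have "z \<in> U" "y \<in> U" using z y Y unfolding C_def by auto
        then have "(y, z) \<in> r - Id"
          using tot z y(2)[of z] unfolding total_on_def by blast
        then show ?thesis using z Y \<open>y \<in> U\<close> unfolding C_def by blast
      qed
      then show "\<exists>y\<in>Y. \<forall>z\<in>Y. z \<noteq> y \<longrightarrow> R z y" using y by blast
    qed
    fix u assume u: "u \<in> U"
    define D where "D = {v\<in>U. v = u \<or> R v u}"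
    have "u \<in> D" using u D_def by blast
    then obtain v where v: "v \<in> D" "\<And>z. (z, v) \<in> r - Id \<Longrightarrow> z \<notin> D"
      using wfE_min[OF wfr, of u D] by metis
    have "R v t" if t: "t \<in> U" "(t, v) \<in> r - Id" for t
    proof -
      have "t \<noteq> u" "\<not> R t u" using v(2)[OF t(2)] t(1) unfolding D_def by blast+
      then have "R u t" using linD(3)[OF True t(1) u] by blast
      then show ?thesis using v(1) linD(2)[OF True _ u t(1)] unfolding D_def by blast
    qed
    then have "v \<in> C" using v(1) unfolding C_def D_def by blast
    then show "\<exists>c\<in>C. c = u \<or> R c u \<or> \<not> lin R U" using v(1) unfolding D_def by blast
  qed
qed

text \<open>If all well-ordered and all reverse-well-ordered subsets of \<open>V\<close> are countable, then the
  same holds for the Hahn series over \<open>V\<close> with the lexicographic order (Esterle).\<close>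

definition short :: "('a \<Rightarrow> 'a \<Rightarrow> bool) \<Rightarrow> 'a set \<Rightarrow> bool" where
  "short R V \<longleftrightarrow> (\<forall>X\<subseteq>V. wo R X \<or> rwo R X \<longrightarrow> countable X)"

lemma countable_wo_series:
  assumes V: "lin R V" "short R V"
    and A: "\<And>f. f \<in> A \<Longrightarrow> supp f \<subseteq> V \<and> rwo R (supp f)"
    and woA: "wo (sless R) A"
  shows "countable A"
proof (rule ccontr)
  assume unc: "uncountable A"
  have linA: "lin (sless R) A" by (rule lin_sless[OF V(1)]) (use A in blast)
  obtain B where B: "B \<subseteq> A" "uncountable B" and init: "\<And>b. b \<in> B \<Longrightarrow> countable {a\<in>B. sless R a b}"
    by (rule uncountable_wo_segment[OF woA unc linA]) blast
  define U where "U = {p\<in>V. \<exists>f0. countable {f\<in>B. \<not> (\<forall>q\<in>V. q = p \<or> R p q \<longrightarrow> f q = f0 q)}}"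
  have "lin R U" by (rule lin_subset[OF V(1)]) (auto simp: U_def)
  then obtain C where C: "C \<subseteq> U" "rwo R C" "\<And>u. u \<in> U \<Longrightarrow> \<exists>c\<in>C. c = u \<or> R c u"
    using coinitial_rwo[of U R] by metis
  have "C \<subseteq> V" using C U_def by blast
  then have cC: "countable C" using C V(2) unfolding short_def by blast
  have "\<forall>p\<in>C. \<exists>f0. countable {f\<in>B. \<not> (\<forall>q\<in>V. q = p \<or> R p q \<longrightarrow> f q = f0 q)}"
    using C(1) unfolding U_def by auto
  then obtain F where F: "\<And>p. p \<in> C \<Longrightarrow> countable {f\<in>B. \<not> (\<forall>q\<in>V. q = p \<or> R p q \<longrightarrow> f q = F p q)}"
    using bchoice[of C "\<lambda>p f0. countable {f\<in>B. \<not> (\<forall>q\<in>V. q = p \<or> R p q \<longrightarrow> f q = f0 q)}"] by auto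
  define B1 where "B1 = {f\<in>B. \<forall>p\<in>C. \<forall>q\<in>V. q = p \<or> R p q \<longrightarrow> f q = F p q}"
  have "B - B1 \<subseteq> (\<Union>p\<in>C. {f\<in>B. \<not> (\<forall>q\<in>V. q = p \<or> R p q \<longrightarrow> f q = F p q)})"
    unfolding B1_def by blast
  moreover have "countable (\<Union>p\<in>C. {f\<in>B. \<not> (\<forall>q\<in>V. q = p \<or> R p q \<longrightarrow> f q = F p q)})"
    using cC F by (rule countable_UN)
  ultimately have cB1: "countable (B - B1)" using countable_subset by blast
  have agree: "f q = g q" if fg: "f \<in> B1" "g \<in> B1" "q \<in> U" for f g q
  proof -
    obtain c where c: "c \<in> C" "c = q \<or> R c q" using C(3)[OF fg(3)] by blast
    have "q \<in> V" using fg U_def by blast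
    then show ?thesis using c fg unfolding B1_def by auto
  qed
  have uB1: "uncountable B1"
    using cB1 B(2) by (metis countable_Un Un_Diff_cancel Un_upper2 countable_subset)
  then have "B1 \<noteq> {}" by auto
  moreover have "B1 \<subseteq> A" using B B1_def by blast
  ultimately obtain f1 where f1: "f1 \<in> B1" "\<And>f. f \<in> B1 \<Longrightarrow> f \<noteq> f1 \<Longrightarrow> sless R f1 f"
    using woA unfolding wo_def by metis
  define B2 where "B2 = B1 - {f1}"
  have uB2: "uncountable B2" using uB1 unfolding B2_def by (simp add: uncountable_minus_countable)
  have B2A: "B2 \<subseteq> A" "B2 \<subseteq> B" using \<open>B1 \<subseteq> A\<close> B1_def B2_def by auto
  have dsupp: "q \<in> V" if "f \<in> B2" "f q - f1 q \<noteq> 0" for f q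
  proof -
    have "f \<in> A" "f1 \<in> A" using that B2A f1(1) \<open>B1 \<subseteq> A\<close> by auto
    then have "{p. f p \<noteq> 0} \<subseteq> V" "{p. f1 p \<noteq> 0} \<subseteq> V" using A[of f] A[of f1] unfolding supp_def by auto
    moreover have "f q \<noteq> 0 \<or> f1 q \<noteq> 0" using that(2) by auto
    ultimately show ?thesis by blast
  qed
  have "\<exists>p. f p - f1 p > 0 \<and> (\<forall>q. q \<noteq> p \<longrightarrow> f q - f1 q \<noteq> 0 \<longrightarrow> R q p)" if "f \<in> B2" for f
    using f1(2)[of f] that unfolding B2_def pos_def by blast
  then obtain P where P: "\<And>f. f \<in> B2 \<Longrightarrow> f (P f) - f1 (P f) > 0"
    "\<And>f q. f \<in> B2 \<Longrightarrow> q \<noteq> P f \<Longrightarrow> f q - f1 q \<noteq> 0 \<Longrightarrow> R q (P f)" by metis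
  have PV: "P f \<in> V" if "f \<in> B2" for f using dsupp[of f "P f"] P(1)[of f] that by auto
  have PU: "P f \<notin> U" if "f \<in> B2" for f
    using agree[of f f1 "P f"] P(1)[OF that] that f1(1) unfolding B2_def by auto
  have mP: "P f = P g \<or> R (P f) (P g)" if fg: "f \<in> B2" "g \<in> B2" "sless R f g" for f g
  proof (rule ccontr)
    assume "\<not> ?thesis"
    then have R: "R (P g) (P f)" "P f \<noteq> P g" using linD(3)[OF V(1) PV PV] fg by blast+
    have Rn: "\<not> R (P f) (P g)" using linD(4)[OF V(1) PV PV R(1)] fg by blast
    have 0: "g (P f) - f1 (P f) = 0" using P(2)[OF fg(2), of "P f"] R Rn by auto
    have below: "R q (P f)" if "q \<noteq> P f" "f q - g q \<noteq> 0" for q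
    proof (cases "f q - f1 q = 0")
      case True
      then have "g q - f1 q \<noteq> 0" using that by auto
      then show ?thesis using P(2)[OF fg(2), of q] R(1) linD(2)[OF V(1) dsupp[OF fg(2)] PV PV, of q g f] fg
        by (cases "q = P g") auto
    next
      case False
      then show ?thesis using P(2)[OF fg(1) that(1)] by blast
    qed
    have "f (P f) - g (P f) > 0" using P(1)[OF fg(1)] 0 by linarith
    then have "sless R g f" unfolding pos_def using below by blast
    then show False using linD(4)[OF linA] fg B2A by blast
  qed
  have woB: "wo (sless R) X" "lin (sless R) X" if "X \<subseteq> B2" for X
  proof -
    have "X \<subseteq> A" using that B2A by blast
    then show "wo (sless R) X" "lin (sless R) X" by (fact wo_subset[OF woA], fact lin_subset[OF linA])
  qed
  have initX: "countable {a\<in>X. sless R a b}" if "X \<subseteq> B2" "b \<in> X" for X b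
    by (rule countable_subset[OF _ init[of b]]) (use that B2A in auto)
  have "\<exists>p. p \<in> P ` B2 \<and> countable {f\<in>B2. P f \<noteq> p}"
  proof (rule mono_const[OF woB(1) uB2 woB(2), of P R])
    show "\<And>x y. x \<in> P ` B2 \<Longrightarrow> y \<in> P ` B2 \<Longrightarrow> R x y \<Longrightarrow> \<not> R y x"
      by (rule linD(4)[OF V(1)]) (auto simp: PV)
    show "wo R (P ` B2) \<Longrightarrow> countable (P ` B2)"
      using V(2)[unfolded short_def, rule_format, of "P ` B2"] PV by auto
    show "\<And>b. b \<in> B2 \<Longrightarrow> countable {a\<in>B2. sless R a b}" by (rule initX[OF subset_refl])
    show "\<And>f g. f \<in> B2 \<Longrightarrow> g \<in> B2 \<Longrightarrow> sless R f g \<Longrightarrow> P f = P g \<or> R (P f) (P g)" by (rule mP)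
    show "\<exists>p. p \<in> P ` B2 \<and> countable {f\<in>B2. P f \<noteq> p}"
      if "c \<in> P ` B2" "countable {f\<in>B2. P f \<noteq> c}" for c using that by blast
  qed auto
  then obtain p where p: "p \<in> P ` B2" "countable {f\<in>B2. P f \<noteq> p}" by blast
  define B3 where "B3 = {f\<in>B2. P f = p}"
  have "B2 - B3 = {f\<in>B2. P f \<noteq> p}" unfolding B3_def by blast
  then have cB3: "countable (B2 - B3)" using p(2) by simp
  then have uB3: "uncountable B3" using uB2
    by (metis countable_Un Un_Diff_cancel Un_upper2 countable_subset)
  have B32: "B3 \<subseteq> B2" unfolding B3_def by blast
  have pV: "p \<in> V" "p \<notin> U" using p(1) PV PU by auto
  have mc: "f p = g p \<or> f p < g p" if fg: "f \<in> B3" "g \<in> B3" "sless R f g" for f g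
  proof (rule ccontr)
    assume "\<not> ?thesis"
    then have gt: "f p - g p > 0" by auto
    have "R q p" if "q \<noteq> p" "f q - g q \<noteq> 0" for q
      using P(2)[of f q] P(2)[of g q] fg that unfolding B3_def by fastforce
    then have "sless R g f" unfolding pos_def using gt by blast
    then show False using linD(4)[OF linA] fg B2A B32 by blast
  qed
  have "\<exists>c. countable {f\<in>B3. f p \<noteq> c}"
  proof (rule mono_const[OF woB(1)[OF B32] uB3 woB(2)[OF B32], of "\<lambda>f. f p" "(<)"])
    show "wo (<) ((\<lambda>f. f p) ` B3) \<Longrightarrow> countable ((\<lambda>f. f p) ` B3)" by (rule countable_wo_real)
    show "\<And>b. b \<in> B3 \<Longrightarrow> countable {a\<in>B3. sless R a b}" by (rule initX[OF B32])
    show "\<And>f g. f \<in> B3 \<Longrightarrow> g \<in> B3 \<Longrightarrow> sless R f g \<Longrightarrow> f p = g p \<or> f p < g p" by (rule mc)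
    show "\<exists>c. countable {f\<in>B3. f p \<noteq> c}" if "countable {f\<in>B3. f p \<noteq> c}" for c using that by blast
  qed auto
  then obtain c where c: "countable {f\<in>B3. f p \<noteq> c}" by blast
  define f0 where "f0 = f1(p := c)"
  have "\<forall>q\<in>V. q = p \<or> R p q \<longrightarrow> f q = f0 q" if f: "f \<in> B3" "f p = c" for f
  proof (intro ballI impI)
    fix q assume q: "q \<in> V" "q = p \<or> R p q"
    show "f q = f0 q"
    proof (cases "q = p")
      case False
      then have "\<not> R q p" using q linD(4)[OF V(1) pV(1) q(1)] by blast
      then have "f q - f1 q = 0" using P(2)[of f q] f False unfolding B3_def by blast
      then show ?thesis using False unfolding f0_def by simp
    qed (use f in \<open>simp add: f0_def\<close>)
  qed
  then have "{f\<in>B. \<not> (\<forall>q\<in>V. q = p \<or> R p q \<longrightarrow> f q = f0 q)}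
      \<subseteq> (B - B1) \<union> {f1} \<union> (B2 - B3) \<union> {f\<in>B3. f p \<noteq> c}"
    unfolding B2_def by blast
  then have "countable {f\<in>B. \<not> (\<forall>q\<in>V. q = p \<or> R p q \<longrightarrow> f q = f0 q)}"
    by (rule countable_subset) (use cB1 cB3 c in auto)
  then have "p \<in> U" unfolding U_def using pV by blast
  then show False using pV by blast
qed

lemma short_step:
  assumes "lin pless V" "short pless V" "inj_on plog W"
    "\<And>m. m \<in> W \<Longrightarrow> supp (plog m) \<subseteq> V \<and> rwo pless (supp (plog m))"
  shows "short pless W"
  unfolding short_def
proof (intro allI impI)
  fix X assume X: "X \<subseteq> W" "wo pless X \<or> rwo pless X"
  have inj: "inj_on plog X" using assms(3) X(1) inj_on_subset by blast
  show "countable X"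
  proof (cases "wo pless X")
    case True
    have "wo (sless pless) (plog ` X)"
      unfolding wo_def
    proof (intro allI impI)
      fix Y assume Y: "Y \<subseteq> plog ` X" "Y \<noteq> {}"
      then obtain Z where Z: "Z \<subseteq> X" "Y = plog ` Z" by (metis subset_imageE)
      then obtain y where y: "y \<in> Z" "\<forall>z\<in>Z. z \<noteq> y \<longrightarrow> pless y z"
        using True Y(2) unfolding wo_def by (metis image_empty)
      then have "\<forall>z\<in>Z. z \<noteq> y \<longrightarrow> sless pless (plog y) (plog z)"
        using pless_iff by auto
      then show "\<exists>y\<in>Y. \<forall>z\<in>Y. z \<noteq> y \<longrightarrow> sless pless y z"
        unfolding Z(2) using \<open>y \<in> Z\<close> by auto
    qed
    then have "countable (plog ` X)"
      by (rule countable_wo_series[OF assms(1,2), rotated]) (use assms(4) X in auto)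
    then show ?thesis using inj countable_image_inj_on by blast
  next
    case False
    then have rw: "rwo pless X" using X by blast
    define M where "M = (\<lambda>m q. - plog m q)"
    have injM: "inj_on M X" using inj unfolding M_def inj_on_def by (auto simp: fun_eq_iff)
    have "wo (sless pless) (M ` X)"
      unfolding wo_def
    proof (intro allI impI)
      fix Y assume Y: "Y \<subseteq> M ` X" "Y \<noteq> {}"
      then obtain Z where Z: "Z \<subseteq> X" "Y = M ` Z" by (metis subset_imageE)
      then obtain y where y: "y \<in> Z" "\<forall>z\<in>Z. z \<noteq> y \<longrightarrow> pless z y"
        using rw Y(2) unfolding wo_def by (metis image_empty)
      have "sless pless (M y) (M z)" if "pless z y" for z
        using that pless_iff[of z y] unfolding M_def by (simp add: algebra_simps)
      then have "\<forall>z\<in>Z. z \<noteq> y \<longrightarrow> sless pless (M y) (M z)" using y(2) by auto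
      then show "\<exists>y\<in>Y. \<forall>z\<in>Y. z \<noteq> y \<longrightarrow> sless pless y z"
        unfolding Z(2) using y(1) by auto
    qed
    moreover have "supp (M m) = supp (plog m)" for m unfolding M_def supp_def by simp
    ultimately have "countable (M ` X)"
      using assms(4) X by (intro countable_wo_series[OF assms(1,2)]) auto
    then show ?thesis using injM countable_image_inj_on by blast
  qed
qed

lemma pless_Lg_imp: "pless m n \<Longrightarrow> m = Lg i \<Longrightarrow> n = Lg j \<Longrightarrow> j < i"
proof (induction arbitrary: i j rule: pless.induct)
  case (atom j' i')
  then show ?case by simp
next
  case (step n p m)
  then have p: "p = Lg (Suc j)" "i \<noteq> j" by (auto simp: single_def split: if_splits)
  then show ?case using step.IH[of "Lg (Suc i)" "Suc i" "Suc j"] step.prems by auto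
qed

lemma pless_Lg [simp]: "pless (Lg i) (Lg j) \<longleftrightarrow> j < i"
  using pless_Lg_imp pless.atom by blast

lemma lin_Lg: "lin pless (range Lg)"
  unfolding lin_def by auto

lemma short_Lg: "short pless (range Lg)"
  unfolding short_def by (meson countable_subset countableI_type countable_image)

lemma pexp_single [simp]: "pexp (single (Lg (Suc k))) = Lg k"
  unfolding pexp_def by auto

lemma pexp_plog_Lg [simp]: "pexp (plog (Lg k)) = Lg k"
  by simp

definition alevel :: "nat \<Rightarrow> nat \<Rightarrow> pmono set" where
  "alevel k h = range Lg \<union> level k h"

definition reg :: "pmono set \<Rightarrow> pmono \<Rightarrow> bool" where
  "reg V m \<longleftrightarrow> pexp (plog m) = m \<and> supp (plog m) \<subseteq> V \<and> rwo pless (supp (plog m)) \<and> countable (supp (plog m))"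

lemma rwo_empty [simp]: "wo R {}" by (simp add: wo_def)
lemma rwo_single [simp]: "wo R {a}" unfolding wo_def by blast

lemma supp_scale: "supp (\<lambda>p. r * f p) \<subseteq> supp f"
  by (auto simp: supp_def)

lemma supp_zero [simp]: "supp (\<lambda>_. 0) = {}"
  by (auto simp: supp_def)

lemma reg_Lg: "range Lg \<subseteq> V \<Longrightarrow> reg V (Lg k)"
  unfolding reg_def by auto

lemma reg_pexp:
  assumes "supp f \<subseteq> V" "rwo pless (supp f)" "countable (supp f)"
  shows "reg V (pexp f)"
  using assms plog_pexp[OF assms(3)] unfolding reg_def by simp

lemma reg_step:
  assumes "lin pless V" "short pless V" "\<And>m. m \<in> W \<Longrightarrow> reg V m"
  shows "lin pless W" "short pless W"
proof -
  have "inj_on plog W" using assms(3) unfolding reg_def inj_on_def by metis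
  moreover have "\<And>m. m \<in> W \<Longrightarrow> supp (plog m) \<subseteq> V \<and> rwo pless (supp (plog m))"
    using assms(3) unfolding reg_def by blast
  ultimately show "lin pless W" "short pless W"
    using lin_step[OF assms(1)] short_step[OF assms(1,2)] by blast+
qed

lemma reg_level_Suc:
  fixes r :: real
  assumes "lin pless (alevel k h)" "short pless (alevel k h)" "\<gamma> \<in> hahn_up (level k h)"
  defines "f \<equiv> (\<lambda>p. r * single (Lg (Suc k)) p + \<gamma> p)"
  shows "supp f \<subseteq> alevel k h" "rwo pless (supp f)" "countable (supp f)"
proof -
  have g: "supp \<gamma> \<subseteq> level k h" "rwo pless (supp \<gamma>)"
    using assms(3) unfolding hahn_up_def hahn_def by auto
  have s: "supp f \<subseteq> {Lg (Suc k)} \<union> supp \<gamma>"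
    unfolding f_def supp_def by (auto simp: single_def)
  show 1: "supp f \<subseteq> alevel k h" using s g unfolding alevel_def by blast
  have "rwo pless ({Lg (Suc k)} \<union> supp \<gamma>)"
    by (rule rwo_Un[OF assms(1)]) (use g in \<open>auto simp: alevel_def\<close>)
  then show 2: "rwo pless (supp f)" using s by (rule wo_subset)
  show "countable (supp f)" using 1 2 assms(2) unfolding short_def by blast
qed

lemma supp_level0: "supp (\<lambda>p. r * single (Lg (Suc k)) p) \<subseteq> {Lg (Suc k)}"
  using supp_scale[of r "single (Lg (Suc k))"] by simp

lemma alevel_props:
  "lin pless (alevel k h) \<and> short pless (alevel k h) \<and>
   (\<forall>m \<in> level k h. reg (case h of 0 \<Rightarrow> range Lg | Suc h' \<Rightarrow> alevel k h') m)"
proof (induction h)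
  case 0
  have r: "reg (range Lg) m" if lev: "m \<in> level k 0" for m
  proof -
    obtain r where m: "m = pexp (\<lambda>p. r * single (Lg (Suc k)) p)"
      using lev unfolding level.simps by blast
    show ?thesis unfolding m
      using supp_level0[of r k] wo_subset[OF rwo_single supp_level0[of r k]]
      by (intro reg_pexp) (auto intro: countable_subset)
  qed
  then have "\<And>m. m \<in> alevel k 0 \<Longrightarrow> reg (range Lg) m"
    using reg_Lg unfolding alevel_def by auto
  then show ?case using reg_step[OF lin_Lg short_Lg] r by auto
next
  case (Suc h)
  then have L: "lin pless (alevel k h)" and S: "short pless (alevel k h)" by auto
  have r: "reg (alevel k h) m" if m: "m \<in> level k (Suc h)" for m
  proof -
    obtain r \<gamma> where m: "m = pexp (\<lambda>p. r * single (Lg (Suc k)) p + \<gamma> p)" "\<gamma> \<in> hahn_up (level k h)"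
      using m by auto
    show ?thesis unfolding m(1)
      using reg_level_Suc[OF L S m(2), of r] by (intro reg_pexp) auto
  qed
  moreover have "reg (alevel k h) (Lg i)" for i
    by (rule reg_Lg) (auto simp: alevel_def)
  ultimately have "\<And>m. m \<in> alevel k (Suc h) \<Longrightarrow> reg (alevel k h) m"
    unfolding alevel_def[of k "Suc h"] by blast
  then show ?case using reg_step[OF L S] r by auto
qed

lemma lin_level: "lin pless (level k h)"
  using alevel_props[of k h] lin_subset[of pless "alevel k h" "level k h"] unfolding alevel_def by blast

lemma countable_hahn: "f \<in> hahn (level k h) \<Longrightarrow> countable (supp f)"
  using alevel_props[of k h] unfolding short_def hahn_def alevel_def by blast

lemma level_pexp_plog: "m \<in> level k h \<Longrightarrow> pexp (plog m) = m"
  using alevel_props[of k h] unfolding reg_def by blast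

lemma plog_level_Suc:
  "\<gamma> \<in> hahn_up (level k h) \<Longrightarrow>
    plog (pexp (\<lambda>p. r * single (Lg (Suc k)) p + \<gamma> p)) = (\<lambda>p. r * single (Lg (Suc k)) p + \<gamma> p)"
  using reg_level_Suc(3)[of k h \<gamma> r] alevel_props[of k h] by (intro plog_pexp) blast

lemma plog_level0: "plog (pexp (\<lambda>p. r * single (Lg (Suc k)) p)) = (\<lambda>p. r * single (Lg (Suc k)) p)"
  by (rule plog_pexp) (auto intro: countable_subset[OF supp_level0])

lemma hahn_up_mono: "S \<subseteq> S' \<Longrightarrow> hahn_up S \<subseteq> hahn_up S'"
  unfolding hahn_up_def hahn_def by auto

lemma hahn_up_zero [simp]: "(\<lambda>_. 0) \<in> hahn_up S"
  unfolding hahn_up_def hahn_def by simp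

lemma hahn_up_add:
  assumes "lin pless S" "f \<in> hahn_up S" "g \<in> hahn_up S"
  shows "(\<lambda>p. f p + g p) \<in> hahn_up S"
proof -
  have "rwo pless (supp f \<union> supp g)"
    by (rule rwo_Un[OF assms(1)]) (use assms in \<open>auto simp: hahn_up_def hahn_def\<close>)
  then have "rwo pless (supp (\<lambda>p. f p + g p))" by (rule wo_subset[OF _ supp_add])
  moreover have "p \<in> supp f \<union> supp g" if "p \<in> supp (\<lambda>p. f p + g p)" for p
    using that supp_add[of f g] by auto
  ultimately show ?thesis using assms(2,3) unfolding hahn_up_def hahn_def by fast
qed

lemma hahn_up_scale:
  assumes "f \<in> hahn_up S"
  shows "(\<lambda>p. r * f p) \<in> hahn_up S"
  using assms supp_scale[of r f] wo_subset[OF _ supp_scale[of r f]]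
  unfolding hahn_up_def hahn_def by blast

lemma level_one: "pexp (\<lambda>_. 0) \<in> level k h"
proof (cases h)
  case 0
  then show ?thesis by (auto intro!: exI[of _ 0])
next
  case (Suc h')
  then show ?thesis by (auto intro!: exI[of _ 0] exI[of _ "\<lambda>_. 0"])
qed

lemma level_comb:
  assumes "m \<in> level k h" "n \<in> level k h"
  shows "pexp (\<lambda>p. a * plog m p + b * plog n p) \<in> level k h
    \<and> plog (pexp (\<lambda>p. a * plog m p + b * plog n p)) = (\<lambda>p. a * plog m p + b * plog n p)"
proof (cases h)
  case 0
  then obtain r r' where m: "m = pexp (\<lambda>p. r * single (Lg (Suc k)) p)"
    and n: "n = pexp (\<lambda>p. r' * single (Lg (Suc k)) p)" using assms by auto
  have eq: "(\<lambda>p. a * plog m p + b * plog n p) = (\<lambda>p. (a * r + b * r') * single (Lg (Suc k)) p)"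
    unfolding m n plog_level0 by (auto simp: algebra_simps)
  show ?thesis unfolding eq plog_level0 0 by auto
next
  case (Suc h')
  then obtain r \<gamma> r' \<gamma>' where m: "m = pexp (\<lambda>p. r * single (Lg (Suc k)) p + \<gamma> p)" "\<gamma> \<in> hahn_up (level k h')"
    and n: "n = pexp (\<lambda>p. r' * single (Lg (Suc k)) p + \<gamma>' p)" "\<gamma>' \<in> hahn_up (level k h')"
    using assms by auto
  define \<delta> where "\<delta> = (\<lambda>p. a * \<gamma> p + b * \<gamma>' p)"
  have d: "\<delta> \<in> hahn_up (level k h')"
    unfolding \<delta>_def by (intro hahn_up_add hahn_up_scale lin_level m n)
  have eq: "(\<lambda>p. a * plog m p + b * plog n p) = (\<lambda>p. (a * r + b * r') * single (Lg (Suc k)) p + \<delta> p)"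
    unfolding m(1) n(1) plog_level_Suc[OF m(2)] plog_level_Suc[OF n(2)] \<delta>_def by (auto simp: algebra_simps)
  show ?thesis unfolding eq plog_level_Suc[OF d] Suc using d by auto
qed

lemma level_Suc: "level k h \<subseteq> level k (Suc h)"
proof (induction h)
  case 0
  have "pexp (\<lambda>p. r * single (Lg (Suc k)) p) \<in> level k (Suc 0)" for r
    unfolding level.simps(2) mem_Collect_eq
    by (intro exI[of _ r] exI[of _ "\<lambda>_. 0"]) (simp del: level.simps)
  then show ?case unfolding level.simps(1) by blast
next
  case (Suc h)
  show ?case using hahn_up_mono[OF Suc] level.simps(2)[of k h] level.simps(2)[of k "Suc h"] by blast
qed

lemma level_mono: "h \<le> h' \<Longrightarrow> level k h \<subseteq> level k h'"
  by (rule lift_Suc_mono_le[of "level k"]) (use level_Suc in auto)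

lemma level_lift: "level k h \<subseteq> level (Suc k) (Suc h)"
proof -
  have "Lg (Suc k) = pexp (\<lambda>p. 1 * single (Lg (Suc (Suc k))) p)" by simp
  then have L0: "Lg (Suc k) \<in> level (Suc k) 0" unfolding level.simps by blast
  have "plog (pexp (\<lambda>_. 0)) = (\<lambda>_. 0)" by (rule plog_pexp) simp
  then have "pless (pexp (\<lambda>_. 0)) (Lg (Suc k))"
    unfolding pless_iff[of "pexp (\<lambda>_. 0)"] pos_def
    by (auto intro!: exI[of _ "Lg (Suc (Suc k))"] simp: single_def)
  then have s0: "single (Lg (Suc k)) \<in> hahn_up (level (Suc k) 0)"
    using L0 unfolding hahn_up_def hahn_def by simp
  have s: "(\<lambda>p. r * single (Lg (Suc k)) p) \<in> hahn_up (level (Suc k) h)" for r h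
    by (rule hahn_up_scale, rule subsetD[OF hahn_up_mono s0], rule level_mono) simp
  have up: "pexp \<gamma> \<in> level (Suc k) (Suc h)" if "\<gamma> \<in> hahn_up (level (Suc k) h)" for \<gamma> h
    using that by (auto intro!: exI[of _ 0])
  show ?thesis
  proof (induction h)
    case 0
    then show ?case using up[OF s] by (auto simp del: level.simps(2))
  next
    case (Suc h)
    show ?case
    proof
      fix m assume "m \<in> level k (Suc h)"
      then obtain r \<gamma> where m: "m = pexp (\<lambda>p. r * single (Lg (Suc k)) p + \<gamma> p)" "\<gamma> \<in> hahn_up (level k h)"
        by auto
      have "\<gamma> \<in> hahn_up (level (Suc k) (Suc h))" using m(2) hahn_up_mono[OF Suc] by blast
      then show "m \<in> level (Suc k) (Suc (Suc h))"
        unfolding m(1) by (intro up hahn_up_add lin_level s)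
    qed
  qed
qed

lemma level_lift_add: "level k h \<subseteq> level (k + i) (h + i)"
proof (induction i)
  case (Suc i)
  then show ?case using level_lift[of "k + i" "h + i"] by (simp del: level.simps)
qed simp

lemma level_directed: "level k h \<union> level k' h' \<subseteq> level (k + k') (h + h' + k + k')"
proof -
  have "level k h \<subseteq> level (k + k') (h + h' + k + k')"
    using level_lift_add[of k h k'] level_mono[of "h + k'" "h + h' + k + k'" "k + k'"] by auto
  moreover have "level k' h' \<subseteq> level (k + k') (h + h' + k + k')"
    using level_lift_add[of k' h' k] level_mono[of "h' + k" "h + h' + k + k'" "k + k'"]
    by (auto simp: add.commute)
  ultimately show ?thesis by blast
qed

definition mons :: "pmono set" where "mons = (\<Union>k h. level k h)"

lemma lin_mons: "lin pless mons"
proof -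
  have "\<exists>k h. {x, y, z} \<subseteq> level k h" if xyz: "x \<in> mons" "y \<in> mons" "z \<in> mons" for x y z
  proof -
    obtain k h k' h' k2 h2 where "x \<in> level k h" "y \<in> level k' h'" "z \<in> level k2 h2"
      using xyz unfolding mons_def by blast
    then have "{x, y, z} \<subseteq> level (k + k' + k2) ((h + h' + k + k') + h2 + (k + k') + k2)"
      using level_directed[of k h k' h'] level_directed[of "k+k'" "h + h' + k + k'" k2 h2] by blast
    then show ?thesis by blast
  qed
  then have *: "\<exists>k h. x \<in> level k h \<and> y \<in> level k h \<and> z \<in> level k h"
    if "x \<in> mons" "y \<in> mons" "z \<in> mons" for x y z using that by (metis insert_subset)
  show ?thesis unfolding lin_def
  proof (intro conjI ballI impI)
    fix x assume "x \<in> mons"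
    then show "\<not> pless x x" using linD(1)[OF lin_level] unfolding mons_def by blast
  next
    fix x y z assume a: "x \<in> mons" "y \<in> mons" "z \<in> mons" "pless x y" "pless y z"
    then obtain k h where "x \<in> level k h" "y \<in> level k h" "z \<in> level k h" using * by blast
    then show "pless x z" using linD(2)[OF lin_level] a(4,5) by blast
  next
    fix x y assume a: "x \<in> mons" "y \<in> mons"
    then obtain k h where "x \<in> level k h" "y \<in> level k h" using * by blast
    then show "x = y \<or> pless x y \<or> pless y x" using linD(3)[OF lin_level] by blast
  qed
qed

lemma mons_comb:
  assumes "m \<in> mons" "n \<in> mons"
  shows "pexp (\<lambda>p. a * plog m p + b * plog n p) \<in> mons"
    and "plog (pexp (\<lambda>p. a * plog m p + b * plog n p)) = (\<lambda>p. a * plog m p + b * plog n p)"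
proof -
  obtain k h k' h' where "m \<in> level k h" "n \<in> level k' h'"
    using assms unfolding mons_def by blast
  then have "m \<in> level (k + k') (h + h' + k + k')" "n \<in> level (k + k') (h + h' + k + k')"
    using level_directed[of k h k' h'] by blast+
  note level_comb[OF this, of a b]
  then show "pexp (\<lambda>p. a * plog m p + b * plog n p) \<in> mons"
    "plog (pexp (\<lambda>p. a * plog m p + b * plog n p)) = (\<lambda>p. a * plog m p + b * plog n p)"
    unfolding mons_def by blast+
qed

lemma mons_one: "pexp (\<lambda>_. 0) \<in> mons"
  using level_one unfolding mons_def by blast

lemma mons_Lg: "Lg k \<in> mons"
proof -
  have "Lg k = pexp (\<lambda>p. 1 * single (Lg (Suc k)) p)" by simp
  then have "Lg k \<in> level k 0" unfolding level.simps by blast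
  then show ?thesis unfolding mons_def by blast
qed

lemma mons_pexp_plog: "m \<in> mons \<Longrightarrow> pexp (plog m) = m"
  unfolding mons_def using level_pexp_plog by blast

typedef monomial = mons morphisms rep_mon abs_mon
  using mons_one by blast

abbreviation mlog :: "monomial \<Rightarrow> pmono \<Rightarrow> real" where
  "mlog m \<equiv> plog (rep_mon m)"

instantiation monomial :: "{linorder, comm_monoid_mult, inverse}"
begin

definition "1 = abs_mon (pexp (\<lambda>_. 0))"
definition "m * n = abs_mon (pexp (\<lambda>p. mlog m p + mlog n p))"
definition "inverse m = abs_mon (pexp (\<lambda>p. - mlog m p))"
definition "m div n = m * inverse (n :: monomial)"
definition "m < n \<longleftrightarrow> pless (rep_mon m) (rep_mon n)"
definition "m \<le> n \<longleftrightarrow> m = n \<or> m < (n :: monomial)"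

lemma mlog_inject: "mlog m = mlog n \<Longrightarrow> m = n"
  by (metis mons_pexp_plog rep_mon rep_mon_inject)

lemma mlog_one: "mlog 1 = (\<lambda>_. 0)"
  unfolding one_monomial_def using mons_one by (simp add: abs_mon_inverse plog_pexp)

lemma rep_mon_mult: "rep_mon (m * n) = pexp (\<lambda>p. mlog m p + mlog n p)"
  using mons_comb(1)[OF rep_mon rep_mon, of 1 m 1 n]
  unfolding times_monomial_def by (simp add: abs_mon_inverse)

lemma mlog_mult: "mlog (m * n) = (\<lambda>p. mlog m p + mlog n p)"
  using mons_comb(2)[OF rep_mon rep_mon, of 1 m 1 n] unfolding rep_mon_mult by simp

lemma rep_mon_minv: "rep_mon (inverse m) = pexp (\<lambda>p. - mlog m p)"
  using mons_comb(1)[OF rep_mon rep_mon, of "-1" m 0 m]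
  unfolding inverse_monomial_def by (simp add: abs_mon_inverse)

lemma mlog_inverse: "mlog (inverse m) = (\<lambda>p. - mlog m p)"
  using mons_comb(2)[OF rep_mon rep_mon, of "-1" m 0 m] unfolding rep_mon_minv by simp

instance
proof
  fix a b c :: monomial
  show "a * b * c = a * (b * c)"
    by (rule mlog_inject) (simp add: mlog_mult add.assoc)
  show "a * b = b * a"
    by (rule mlog_inject) (simp add: mlog_mult add.commute)
  show "1 * a = a"
    by (rule mlog_inject) (simp add: mlog_mult mlog_one)
  have L: "lin pless mons" by (rule lin_mons)
  note r = rep_mon[of a] rep_mon[of b] rep_mon[of c]
  show "(a < b) = (a \<le> b \<and> \<not> b \<le> a)"
    unfolding less_eq_monomial_def less_monomial_def
    using linD(1)[OF L r(1)] linD(4)[OF L r(1,2)] by auto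
  show "a \<le> a" by (simp add: less_eq_monomial_def)
  show "a \<le> c" if "a \<le> b" "b \<le> c"
    using that linD(2)[OF L r] unfolding less_eq_monomial_def less_monomial_def by auto
  show "a = b" if "a \<le> b" "b \<le> a"
    using that linD(4)[OF L r(1,2)] unfolding less_eq_monomial_def less_monomial_def by auto
  show "a \<le> b \<or> b \<le> a"
    using linD(3)[OF L r(1,2)] unfolding less_eq_monomial_def less_monomial_def
    by (auto simp: rep_mon_inject)
qed

end

lemma mon_left_inverse [simp]: "inverse m * m = (1 :: monomial)"
  by (rule mlog_inject) (simp add: mlog_mult mlog_one mlog_inverse)

lemma mon_right_inverse [simp]: "m * inverse m = (1 :: monomial)"
  using mon_left_inverse[of m] by (simp add: mult.commute)

lemma mon_cancel_left [simp]: "p * m = p * n \<longleftrightarrow> m = (n :: monomial)"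
  by (metis mon_left_inverse mult.assoc mult_1)

lemma mon_less_mult [simp]: "p * m < p * n \<longleftrightarrow> m < (n :: monomial)"
  unfolding less_monomial_def pless_iff[of "rep_mon (p * m)"] pless_iff[of "rep_mon m"] mlog_mult by simp

lemma mon_le_mult [simp]: "p * m \<le> p * n \<longleftrightarrow> m \<le> (n :: monomial)"
  by (simp add: less_eq_monomial_def)

lemma mon_cancel_right [simp]: "m * p = n * p \<longleftrightarrow> m = (n :: monomial)"
  using mon_cancel_left[of p m n] by (simp add: mult.commute)

lemma mon_less_mult_right [simp]: "m * p < n * p \<longleftrightarrow> m < (n :: monomial)"
  using mon_less_mult[of p m n] by (simp add: mult.commute)

lemma mon_le_mult_right [simp]: "m * p \<le> n * p \<longleftrightarrow> m \<le> (n :: monomial)"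
  using mon_le_mult[of p m n] by (simp add: mult.commute)

lemma mon_mult_less: "a < c \<Longrightarrow> b \<le> d \<Longrightarrow> a * b < c * (d :: monomial)"
  by (meson le_less_trans mon_le_mult mon_less_mult_right)

lemma mon_mult_le: "a \<le> c \<Longrightarrow> b \<le> d \<Longrightarrow> a * b \<le> c * (d :: monomial)"
  by (meson order_trans mon_le_mult mon_le_mult_right)

definition well_based :: "'a::linorder set \<Rightarrow> bool" where
  "well_based X \<longleftrightarrow> (\<forall>Y\<subseteq>X. Y \<noteq> {} \<longrightarrow> (\<exists>m\<in>Y. \<forall>n\<in>Y. n \<le> m))"

lemma well_based_subset: "well_based X \<Longrightarrow> Y \<subseteq> X \<Longrightarrow> well_based Y"
  unfolding well_based_def by (meson subset_trans)

lemma well_based_finite: "finite X \<Longrightarrow> well_based X"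
  unfolding well_based_def by (metis Max_ge Max_in finite_subset)

lemma well_based_iff: "well_based X \<longleftrightarrow> (\<nexists>s::nat \<Rightarrow> _. (\<forall>n. s n \<in> X) \<and> strict_mono s)"
proof
  assume X: "well_based X"
  show "\<nexists>s::nat \<Rightarrow> _. (\<forall>n. s n \<in> X) \<and> strict_mono s"
  proof
    assume "\<exists>s::nat \<Rightarrow> _. (\<forall>n. s n \<in> X) \<and> strict_mono s"
    then obtain s :: "nat \<Rightarrow> _" where s: "\<And>n. s n \<in> X" "strict_mono s" by blast
    have "range s \<subseteq> X" "range s \<noteq> {}" using s by auto
    then obtain m where "m \<in> range s" "\<forall>n\<in>range s. n \<le> m" using X unfolding well_based_def by blast
    then obtain k where "s (Suc k) \<le> s k" by auto
    then show False using strict_monoD[OF s(2), of k "Suc k"] by simp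
  qed
next
  assume no: "\<nexists>s::nat \<Rightarrow> _. (\<forall>n. s n \<in> X) \<and> strict_mono s"
  show "well_based X" unfolding well_based_def
  proof (intro allI impI, rule ccontr)
    fix Y assume Y: "Y \<subseteq> X" "Y \<noteq> {}" "\<not> (\<exists>m\<in>Y. \<forall>n\<in>Y. n \<le> m)"
    then have "\<exists>s. \<forall>n::nat. s n \<in> Y \<and> s n < s (Suc n)"
      by (intro dependent_nat_choice) (auto simp: not_le)
    then obtain s :: "nat \<Rightarrow> _" where "\<And>n. s n \<in> Y \<and> s n < s (Suc n)" by blast
    then have "(\<forall>n. s n \<in> X) \<and> strict_mono s" using Y(1) by (auto simp: strict_mono_Suc_iff)
    then show False using no by blast
  qed
qed

lemma well_based_antimono_subseq:
  fixes s :: "nat \<Rightarrow> 'a::linorder"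
  assumes "well_based X" "\<And>n. s n \<in> X"
  obtains r where "strict_mono r" "decseq (s \<circ> r)"
proof -
  obtain f where f: "strict_mono f" "monoseq (\<lambda>n. s (f n))" using seq_monosub[of s] by blast
  show ?thesis
  proof (cases "decseq (\<lambda>n. s (f n))")
    case True
    then show ?thesis using that[of f] f by (simp add: o_def)
  next
    case False
    then have inc: "incseq (\<lambda>n. s (f n))" using f(2) by (auto simp: monoseq_iff)
    have "range (\<lambda>n. s (f n)) \<subseteq> X" "range (\<lambda>n. s (f n)) \<noteq> {}" using assms(2) by auto
    then have "\<exists>m\<in>range (\<lambda>n. s (f n)). \<forall>n\<in>range (\<lambda>n. s (f n)). n \<le> m"
      using assms(1)[unfolded well_based_def, rule_format] by blast
    then obtain N where N: "\<And>n. s (f n) \<le> s (f N)" by auto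
    then have c: "s (f (n + N)) = s (f N)" for n
      using incseqD[OF inc, of N "n + N"] by (simp add: antisym)
    show ?thesis
    proof (rule that[of "\<lambda>n. f (n + N)"])
      show "strict_mono (\<lambda>n. f (n + N))" using f(1) by (auto simp: strict_mono_def)
      show "decseq (s \<circ> (\<lambda>n. f (n + N)))" using c by (simp add: o_def decseq_def)
    qed
  qed
qed

lemma well_based_Un:
  assumes "well_based A" "well_based B"
  shows "well_based (A \<union> B)"
  unfolding well_based_def
proof (intro allI impI)
  fix Y assume Y: "Y \<subseteq> A \<union> B" "Y \<noteq> {}"
  have a: "Y \<inter> A = {} \<or> (\<exists>m\<in>Y \<inter> A. \<forall>n\<in>Y \<inter> A. n \<le> m)"
    using assms(1)[unfolded well_based_def, rule_format, of "Y \<inter> A"] by auto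
  have b: "Y \<inter> B = {} \<or> (\<exists>m\<in>Y \<inter> B. \<forall>n\<in>Y \<inter> B. n \<le> m)"
    using assms(2)[unfolded well_based_def, rule_format, of "Y \<inter> B"] by auto
  show "\<exists>m\<in>Y. \<forall>n\<in>Y. n \<le> m"
  proof (cases "Y \<inter> A = {} \<or> Y \<inter> B = {}")
    case True
    then have "Y \<inter> A = Y \<or> Y \<inter> B = Y" using Y by blast
    then show ?thesis using a b Y(2) by auto
  next
    case False
    then obtain p q where "p \<in> Y \<inter> A" "\<And>n. n \<in> Y \<inter> A \<Longrightarrow> n \<le> p" "q \<in> Y \<inter> B" "\<And>n. n \<in> Y \<inter> B \<Longrightarrow> n \<le> q"
      using a b by blast
    then have "\<forall>n\<in>Y. n \<le> max p q" "max p q \<in> Y"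
      using Y(1) unfolding le_max_iff_disj by (blast, auto simp: max_def)
    then show ?thesis by blast
  qed
qed

definition mprod :: "monomial set \<Rightarrow> monomial set \<Rightarrow> monomial set" where
  "mprod A B = {a * b | a b. a \<in> A \<and> b \<in> B}"

lemma well_based_mprod:
  assumes "well_based A" "well_based B"
  shows "well_based (mprod A B)"
  unfolding well_based_iff
proof
  assume "\<exists>s::nat \<Rightarrow> _. (\<forall>n. s n \<in> mprod A B) \<and> strict_mono s"
  then obtain s :: "nat \<Rightarrow> monomial" where s: "\<And>n. s n \<in> mprod A B" "strict_mono s" by blast
  have "\<exists>a b. a \<in> A \<and> b \<in> B \<and> s n = a * b" for n using s(1)[of n] unfolding mprod_def by auto
  then obtain a b where ab: "\<And>n. a n \<in> A" "\<And>n. b n \<in> B" "\<And>n. s n = a n * b n" by metis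
  obtain r where r: "strict_mono r" "decseq (a \<circ> r)"
    using well_based_antimono_subseq[of A a] assms(1) ab(1) by blast
  have "b (r n) < b (r (Suc n))" for n
  proof (rule ccontr)
    assume "\<not> ?thesis"
    then have "b (r (Suc n)) \<le> b (r n)" by simp
    moreover have "a (r (Suc n)) \<le> a (r n)" using decseqD[OF r(2), of n "Suc n"] by simp
    ultimately have "s (r (Suc n)) \<le> s (r n)" unfolding ab(3) by (intro mon_mult_le)
    moreover have "r n < r (Suc n)" using r(1) by (simp add: strict_mono_Suc_iff)
    ultimately show False using strict_monoD[OF s(2), of "r n" "r (Suc n)"] by simp
  qed
  then have "strict_mono (b \<circ> r)" by (simp add: strict_mono_Suc_iff)
  moreover have "\<forall>n. (b \<circ> r) n \<in> B" using ab(2) by simp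
  ultimately show False using assms(2) unfolding well_based_iff by blast
qed

definition cpairs :: "monomial set \<Rightarrow> monomial set \<Rightarrow> monomial \<Rightarrow> (monomial \<times> monomial) set" where
  "cpairs A B m = {(a, b). a \<in> A \<and> b \<in> B \<and> a * b = m}"

lemma finite_cpairs:
  assumes "well_based A" "well_based B"
  shows "finite (cpairs A B m)"
proof (rule ccontr)
  assume inf: "infinite (cpairs A B m)"
  have "inj_on fst (cpairs A B m)" unfolding inj_on_def cpairs_def by auto
  then have "infinite (fst ` cpairs A B m)" using inf finite_imageD by blast
  then obtain s :: "nat \<Rightarrow> monomial" where s: "inj s" "range s \<subseteq> fst ` cpairs A B m"
    using infinite_countable_subset by blast
  have "\<exists>b. s n \<in> A \<and> b \<in> B \<and> s n * b = m" for n using s(2) unfolding cpairs_def by force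
  then obtain b where b: "\<And>n. s n \<in> A" "\<And>n. b n \<in> B" "\<And>n. s n * b n = m" by metis
  obtain r where r: "strict_mono r" "decseq (s \<circ> r)"
    using well_based_antimono_subseq[of A s] assms(1) b(1) by blast
  have "b (r n) < b (r (Suc n))" for n
  proof (rule ccontr)
    assume "\<not> ?thesis"
    then have "b (r (Suc n)) \<le> b (r n)" by simp
    moreover have "s (r (Suc n)) \<le> s (r n)" using decseqD[OF r(2), of n "Suc n"] by simp
    moreover have "r n \<noteq> r (Suc n)" using r(1) by (metis n_not_Suc_n strict_mono_eq)
    then have "s (r (Suc n)) \<noteq> s (r n)" using s(1) by (auto dest: injD)
    ultimately have "s (r (Suc n)) * b (r (Suc n)) < s (r n) * b (r n)"
      by (intro mon_mult_less) auto
    then show False unfolding b(3) by simp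
  qed
  then have "strict_mono (b \<circ> r)" by (simp add: strict_mono_Suc_iff)
  moreover have "\<forall>n. (b \<circ> r) n \<in> B" using b(2) by simp
  ultimately show False using assms(2) unfolding well_based_iff by blast
qed

definition mlevel :: "nat \<Rightarrow> nat \<Rightarrow> monomial set" where
  "mlevel k h = {m. rep_mon m \<in> level k h}"

lemma mlevel_one: "1 \<in> mlevel k h"
  unfolding mlevel_def one_monomial_def using level_one mons_one by (simp add: abs_mon_inverse)

lemma mlevel_mult: "m \<in> mlevel k h \<Longrightarrow> n \<in> mlevel k h \<Longrightarrow> m * n \<in> mlevel k h"
  using level_comb[of "rep_mon m" k h "rep_mon n" 1 1] by (simp add: mlevel_def rep_mon_mult)

lemma mlevel_inverse: "m \<in> mlevel k h \<Longrightarrow> inverse m \<in> mlevel k h"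
  using level_comb[of "rep_mon m" k h "rep_mon m" "-1" 0] by (simp add: mlevel_def rep_mon_minv)

lemma mlevel_directed: "mlevel k h \<union> mlevel k' h' \<subseteq> mlevel (k + k') (h + h' + k + k')"
  using level_directed unfolding mlevel_def by blast

lemma mlevel_cover: "\<exists>k h. m \<in> mlevel k h"
  using rep_mon[of m] unfolding mons_def mlevel_def by blast

lemma mprod_mlevel: "A \<subseteq> mlevel k h \<Longrightarrow> B \<subseteq> mlevel k h \<Longrightarrow> mprod A B \<subseteq> mlevel k h"
  unfolding mprod_def using mlevel_mult by blast

text \<open>An LE-series is a Hahn series whose support lies in a single level, so \<open>T\<close> is the directed union
of the full Hahn fields over the levels.\<close>

typedef transseries = "{f :: monomial \<Rightarrow> real. (\<exists>k h. supp f \<subseteq> mlevel k h) \<and> well_based (supp f)}"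
  morphisms coeff abs_ts
  by (intro exI[of _ "\<lambda>_. 0"]) (auto simp: well_based_def)

setup_lifting type_definition_transseries

lemma coeff_props: "\<exists>k h. supp (coeff F) \<subseteq> mlevel k h" "well_based (supp (coeff F))"
  using coeff[of F] by auto

lemma ts_eqI: "(\<And>m. coeff F m = coeff G m) \<Longrightarrow> F = G"
  using coeff_inject by blast

lemma coeff_abs:
  assumes "supp f \<subseteq> mlevel k h" "well_based (supp f)"
  shows "coeff (abs_ts f) = f"
  using assms by (intro abs_ts_inverse) blast

lemma common_level:
  obtains k h where "supp (coeff F) \<subseteq> mlevel k h" "supp (coeff G) \<subseteq> mlevel k h"
proof -
  obtain k h k' h' where "supp (coeff F) \<subseteq> mlevel k h" "supp (coeff G) \<subseteq> mlevel k' h'"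
    using coeff_props(1) by metis
  then show ?thesis using mlevel_directed[of k h k' h'] that by blast
qed

definition conv :: "(monomial \<Rightarrow> real) \<Rightarrow> (monomial \<Rightarrow> real) \<Rightarrow> monomial \<Rightarrow> real" where
  "conv f g m = (\<Sum>(p, q) \<in> {(p, q). p \<in> supp f \<and> q \<in> supp g \<and> p * q = m}. f p * g q)"

lemma mprodI: "a \<in> A \<Longrightarrow> b \<in> B \<Longrightarrow> a * b \<in> mprod A B"
  unfolding mprod_def by blast

lemma supp_conv: "supp (conv f g) \<subseteq> mprod (supp f) (supp g)"
proof
  fix m assume "m \<in> supp (conv f g)"
  then have "conv f g m \<noteq> 0" by (simp add: supp_def)
  moreover have "conv f g m = 0" if "{(p, q). p \<in> supp f \<and> q \<in> supp g \<and> p * q = m} = {}"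
    unfolding conv_def that by simp
  ultimately have "{(p, q). p \<in> supp f \<and> q \<in> supp g \<and> p * q = m} \<noteq> {}" by blast
  then show "m \<in> mprod (supp f) (supp g)" unfolding mprod_def by blast
qed

lemma conv_cpairs:
  assumes "supp f \<subseteq> A" "supp g \<subseteq> B" "well_based A" "well_based B"
  shows "conv f g m = (\<Sum>(p, q) \<in> cpairs A B m. f p * g q)"
  unfolding conv_def
  by (rule sum.mono_neutral_left[OF finite_cpairs[OF assms(3,4)]])
     (use assms in \<open>auto simp: cpairs_def supp_def\<close>)

lemma supp_minus: "supp (\<lambda>m. - f m) = supp f" by (simp add: supp_def)

instantiation transseries :: "{zero, one, plus, minus, uminus, times}"
begin

lift_definition zero_transseries :: transseries is "\<lambda>_. 0"
  by (simp add: well_based_def)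

lift_definition one_transseries :: transseries is "single 1"
  using mlevel_one by (auto intro: well_based_finite)

lift_definition plus_transseries :: "transseries \<Rightarrow> transseries \<Rightarrow> transseries" is "\<lambda>f g m. f m + g m"
proof -
  fix f g :: "monomial \<Rightarrow> real"
  assume a: "(\<exists>k h. supp f \<subseteq> mlevel k h) \<and> well_based (supp f)" "(\<exists>k h. supp g \<subseteq> mlevel k h) \<and> well_based (supp g)"
  then obtain k h k' h' where "supp f \<subseteq> mlevel k h" "supp g \<subseteq> mlevel k' h'" by blast
  then have "supp f \<union> supp g \<subseteq> mlevel (k + k') (h + h' + k + k')"
    using mlevel_directed[of k h k' h'] by blast
  moreover have "well_based (supp f \<union> supp g)" using a well_based_Un by blast
  ultimately show "(\<exists>k h. supp (\<lambda>m. f m + g m) \<subseteq> mlevel k h) \<and> well_based (supp (\<lambda>m. f m + g m))"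
    using supp_add[of f g] well_based_subset by (meson subset_trans)
qed

lift_definition uminus_transseries :: "transseries \<Rightarrow> transseries" is "\<lambda>f m. - f m"
  by (simp add: supp_minus)

definition minus_transseries :: "transseries \<Rightarrow> transseries \<Rightarrow> transseries" where
  "minus_transseries F G = F + (- G)"

lift_definition times_transseries :: "transseries \<Rightarrow> transseries \<Rightarrow> transseries" is conv
proof -
  fix f g :: "monomial \<Rightarrow> real"
  assume a: "(\<exists>k h. supp f \<subseteq> mlevel k h) \<and> well_based (supp f)" "(\<exists>k h. supp g \<subseteq> mlevel k h) \<and> well_based (supp g)"
  then obtain k h k' h' where "supp f \<subseteq> mlevel k h" "supp g \<subseteq> mlevel k' h'" by blast
  then have "mprod (supp f) (supp g) \<subseteq> mlevel (k + k') (h + h' + k + k')"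
    using mlevel_directed[of k h k' h'] by (intro mprod_mlevel) blast+
  moreover have "well_based (mprod (supp f) (supp g))" using a well_based_mprod by blast
  ultimately show "(\<exists>k h. supp (conv f g) \<subseteq> mlevel k h) \<and> well_based (supp (conv f g))"
    using supp_conv[of f g] well_based_subset by (meson subset_trans)
qed

instance ..

end

lemma coeff_simps [simp]:
  "coeff 0 m = 0" "coeff (F + G) m = coeff F m + coeff G m"
  "coeff (- F) m = - coeff F m" "coeff (F - G) m = coeff F m - coeff G m"
  by (simp_all add: zero_transseries.rep_eq plus_transseries.rep_eq uminus_transseries.rep_eq minus_transseries_def)

lemma coeff_one: "coeff 1 = single 1"
  by (rule one_transseries.rep_eq)

lemma coeff_mult: "coeff (F * G) = conv (coeff F) (coeff G)"
  by (rule times_transseries.rep_eq)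

lemma coeff_mult_superset:
  assumes "supp (coeff F) \<subseteq> A" "supp (coeff G) \<subseteq> B" "well_based A" "well_based B"
  shows "coeff (F * G) m = (\<Sum>(p, q) \<in> cpairs A B m. coeff F p * coeff G q)"
  unfolding coeff_mult by (rule conv_cpairs[OF assms])

instance transseries :: comm_ring_1
proof
  fix F G H :: transseries
  note wb = coeff_props(2)
  show "F + G + H = F + (G + H)" by (rule ts_eqI) simp
  show "F + G = G + F" by (rule ts_eqI) simp
  show "0 + F = F" by (rule ts_eqI) simp
  show "- F + F = 0" by (rule ts_eqI) simp
  show "F - G = F + - G" by (rule ts_eqI) simp
  show "0 \<noteq> (1::transseries)"
  proof
    assume "0 = (1::transseries)"
    then have "coeff 0 1 = coeff 1 1" by metis
    then show False by (simp add: coeff_one)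
  qed
  show "F * G = G * F"
  proof (rule ts_eqI)
    fix m
    show "coeff (F * G) m = coeff (G * F) m"
      unfolding coeff_mult_superset[OF order_refl order_refl wb wb]
      by (rule sum.reindex_bij_witness[of _ prod.swap prod.swap]) (auto simp: cpairs_def mult.commute)
  qed
  show "1 * F = F"
  proof (rule ts_eqI)
    fix m
    have w: "well_based {1::monomial}" by (rule well_based_finite) simp
    have "coeff (1 * F) m = (\<Sum>(p, q) \<in> cpairs {1} (supp (coeff F)) m. coeff 1 p * coeff F q)"
      by (rule coeff_mult_superset) (use w wb in \<open>auto simp: coeff_one\<close>)
    also have "cpairs {1} (supp (coeff F)) m = (if coeff F m = 0 then {} else {(1, m)})"
      by (auto simp: cpairs_def supp_def)
    also have "(\<Sum>(p, q) \<in> (if coeff F m = 0 then {} else {(1, m)}). coeff 1 p * coeff F q) = coeff F m"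
      by (simp add: coeff_one)
    finally show "coeff (1 * F) m = coeff F m" .
  qed
  show "(F + G) * H = F * H + G * H"
  proof (rule ts_eqI)
    fix m
    let ?A = "supp (coeff F) \<union> supp (coeff G)" and ?C = "supp (coeff H)"
    have w: "well_based ?A" by (rule well_based_Un[OF wb wb])
    have "coeff ((F + G) * H) m = (\<Sum>(p, q) \<in> cpairs ?A ?C m. coeff (F + G) p * coeff H q)"
      by (rule coeff_mult_superset) (use w wb in \<open>auto simp: supp_def\<close>)
    also have "\<dots> = (\<Sum>(p, q) \<in> cpairs ?A ?C m. coeff F p * coeff H q)
                  + (\<Sum>(p, q) \<in> cpairs ?A ?C m. coeff G p * coeff H q)"
      unfolding sum.distrib[symmetric] by (rule sum.cong) (auto simp: algebra_simps)
    also have "(\<Sum>(p, q) \<in> cpairs ?A ?C m. coeff F p * coeff H q) = coeff (F * H) m"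
      by (rule coeff_mult_superset[symmetric]) (use w wb in auto)
    also have "(\<Sum>(p, q) \<in> cpairs ?A ?C m. coeff G p * coeff H q) = coeff (G * H) m"
      by (rule coeff_mult_superset[symmetric]) (use w wb in auto)
    finally show "coeff ((F + G) * H) m = coeff (F * H + G * H) m" by simp
  qed
  show "F * G * H = F * (G * H)"
  proof (rule ts_eqI)
    fix m
    let ?A = "supp (coeff F)" and ?B = "supp (coeff G)" and ?C = "supp (coeff H)"
    have w: "well_based (mprod ?A ?B)" "well_based (mprod ?B ?C)" by (intro well_based_mprod wb)+
    have s: "supp (coeff (F * G)) \<subseteq> mprod ?A ?B" "supp (coeff (G * H)) \<subseteq> mprod ?B ?C"
      unfolding coeff_mult by (rule supp_conv)+
    have "coeff (F * G * H) m = (\<Sum>(u, c) \<in> cpairs (mprod ?A ?B) ?C m. coeff (F * G) u * coeff H c)"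
      by (rule coeff_mult_superset) (use w wb s in auto)
    also have "\<dots> = (\<Sum>x \<in> cpairs (mprod ?A ?B) ?C m. \<Sum>y \<in> cpairs ?A ?B (fst x).
        coeff F (fst y) * coeff G (snd y) * coeff H (snd x))"
      unfolding coeff_mult_superset[OF order_refl order_refl wb wb]
      by (rule sum.cong) (auto simp: sum_distrib_right case_prod_unfold)
    also have "\<dots> = (\<Sum>(x, y) \<in> Sigma (cpairs (mprod ?A ?B) ?C m) (\<lambda>x. cpairs ?A ?B (fst x)).
        coeff F (fst y) * coeff G (snd y) * coeff H (snd x))"
      by (rule sum.Sigma) (use finite_cpairs w wb in auto)
    also have "\<dots> = (\<Sum>(a, b, c) \<in> {(a, b, c). a \<in> ?A \<and> b \<in> ?B \<and> c \<in> ?C \<and> a * (b * c) = m}.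
        coeff F a * (coeff G b * coeff H c))"
      by (rule sum.reindex_bij_witness[of _ "\<lambda>(a, b, c). ((a * b, c), (a, b))" "\<lambda>(x, y). (fst y, snd y, snd x)"])
         (auto simp: cpairs_def mult.assoc intro: mprodI)
    also have "\<dots> = (\<Sum>(x, y) \<in> Sigma (cpairs ?A (mprod ?B ?C) m) (\<lambda>x. cpairs ?B ?C (snd x)).
        coeff F (fst x) * (coeff G (fst y) * coeff H (snd y)))"
      by (rule sum.reindex_bij_witness[of _ "\<lambda>(x, y). (fst x, fst y, snd y)" "\<lambda>(a, b, c). ((a, b * c), (b, c))"])
         (auto simp: cpairs_def intro: mprodI)
    also have "\<dots> = (\<Sum>x \<in> cpairs ?A (mprod ?B ?C) m. \<Sum>y \<in> cpairs ?B ?C (snd x).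
        coeff F (fst x) * (coeff G (fst y) * coeff H (snd y)))"
      by (rule sum.Sigma[symmetric]) (use finite_cpairs w wb in auto)
    also have "\<dots> = (\<Sum>(a, v) \<in> cpairs ?A (mprod ?B ?C) m. coeff F a * coeff (G * H) v)"
      unfolding coeff_mult_superset[OF order_refl order_refl wb wb]
      by (rule sum.cong) (auto simp: sum_distrib_left case_prod_unfold)
    also have "\<dots> = coeff (F * (G * H)) m"
      by (rule coeff_mult_superset[symmetric]) (use w wb s in auto)
    finally show "coeff (F * G * H) m = coeff (F * (G * H)) m" .
  qed
qed

instantiation transseries :: linordered_idom
begin

definition less_transseries :: "transseries \<Rightarrow> transseries \<Rightarrow> bool" where
  "F < G \<longleftrightarrow> (\<exists>m. coeff F m < coeff G m \<and> (\<forall>n>m. coeff F n = coeff G n))"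

definition less_eq_transseries :: "transseries \<Rightarrow> transseries \<Rightarrow> bool" where
  "F \<le> G \<longleftrightarrow> F = G \<or> F < (G :: transseries)"

definition abs_transseries :: "transseries \<Rightarrow> transseries" where
  "\<bar>F\<bar> = (if F < 0 then - F else (F :: transseries))"

definition sgn_transseries :: "transseries \<Rightarrow> transseries" where
  "sgn F = (if F = 0 then 0 else if 0 < F then 1 else - 1 :: transseries)"

lemma ts_lead:
  assumes "F \<noteq> 0"
  obtains m where "coeff F m \<noteq> 0" "\<And>n. n > m \<Longrightarrow> coeff F n = 0"
proof -
  have "supp (coeff F) \<noteq> {}" using assms ts_eqI[of F 0] by (auto simp: supp_def)
  then obtain m where "m \<in> supp (coeff F)" "\<And>n. n \<in> supp (coeff F) \<Longrightarrow> n \<le> m"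
    using coeff_props(2)[of F, unfolded well_based_def, rule_format, OF order_refl] by blast
  then show ?thesis using that[of m] by (force simp: supp_def)
qed

lemma ts_less_iff: "F < G \<longleftrightarrow> 0 < G - (F :: transseries)"
proof -
  have "0 = coeff G n - coeff F n \<longleftrightarrow> coeff F n = coeff G n" for n by auto
  then show ?thesis unfolding less_transseries_def coeff_simps by simp
qed

lemma coeff_mult_lead:
  assumes "\<And>n. n > m1 \<Longrightarrow> coeff F n = 0" "\<And>n. n > m2 \<Longrightarrow> coeff G n = 0"
  shows "coeff (F * G) (m1 * m2) = coeff F m1 * coeff G m2"
    and "n > m1 * m2 \<Longrightarrow> coeff (F * G) n = 0"
proof -
  let ?A = "supp (coeff F) \<union> {m1}" and ?B = "supp (coeff G) \<union> {m2}"
  have A: "a \<le> m1" if "a \<in> ?A" for a using assms(1)[of a] that by (cases "m1 < a") (simp_all add: supp_def not_less)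
  have B: "b \<le> m2" if "b \<in> ?B" for b using assms(2)[of b] that by (cases "m2 < b") (simp_all add: supp_def not_less)
  have eq: "a = m1 \<and> b = m2" if "a \<in> ?A" "b \<in> ?B" "m1 * m2 \<le> a * b" for a b
  proof -
    have "\<not> (a < m1)" using mon_mult_less[of a m1 b m2] B[OF that(2)] that(3) by (meson not_le)
    moreover have "\<not> (b < m2)" using mon_mult_less[of b m2 a m1] A[OF that(1)] that(3)
      by (metis mult.commute not_le)
    ultimately show ?thesis using A[OF that(1)] B[OF that(2)] by (meson antisym not_less)
  qed
  have w: "well_based ?A" "well_based ?B"
    by (intro well_based_Un coeff_props(2) well_based_finite; simp)+
  have c: "coeff (F * G) n = (\<Sum>(p, q) \<in> cpairs ?A ?B n. coeff F p * coeff G q)" for n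
    by (rule coeff_mult_superset) (use w in auto)
  have "cpairs ?A ?B (m1 * m2) = {(m1, m2)}"
  proof -
    have "x = (m1, m2)" if "x \<in> cpairs ?A ?B (m1 * m2)" for x
      using eq[of "fst x" "snd x"] that unfolding cpairs_def by (cases x) simp
    moreover have "(m1, m2) \<in> cpairs ?A ?B (m1 * m2)" unfolding cpairs_def by simp
    ultimately show ?thesis by (intro set_eqI) (metis singleton_iff)
  qed
  then show "coeff (F * G) (m1 * m2) = coeff F m1 * coeff G m2" unfolding c by simp
  assume n: "n > m1 * m2"
  have "cpairs ?A ?B n = {}"
  proof -
    have False if "x \<in> cpairs ?A ?B n" for x
    proof -
      have x: "fst x \<in> ?A" "snd x \<in> ?B" "fst x * snd x = n"
        using that unfolding cpairs_def by (cases x; simp)+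
      then have "fst x = m1 \<and> snd x = m2" using eq[OF x(1,2)] n by simp
      then show False using x(3) n by simp
    qed
    then show ?thesis by blast
  qed
  then show "coeff (F * G) n = 0" unfolding c by simp
qed

lemma ts_mult_pos:
  assumes "0 < F" "0 < (G :: transseries)"
  shows "0 < F * G"
proof -
  obtain m1 where m1: "0 < coeff F m1" "\<And>n. n > m1 \<Longrightarrow> coeff F n = 0"
    using assms(1) unfolding less_transseries_def by auto
  obtain m2 where m2: "0 < coeff G m2" "\<And>n. n > m2 \<Longrightarrow> coeff G n = 0"
    using assms(2) unfolding less_transseries_def by auto
  show ?thesis unfolding less_transseries_def
    using coeff_mult_lead[OF m1(2) m2(2)] m1(1) m2(1) by (intro exI[of _ "m1 * m2"]) auto
qed

lemma ts_add_pos: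
  assumes "0 < F" "0 < (G :: transseries)"
  shows "0 < F + G"
proof -
  obtain m1 where m1: "0 < coeff F m1" "\<And>n. n > m1 \<Longrightarrow> coeff F n = 0"
    using assms(1) unfolding less_transseries_def by auto
  obtain m2 where m2: "0 < coeff G m2" "\<And>n. n > m2 \<Longrightarrow> coeff G n = 0"
    using assms(2) unfolding less_transseries_def by auto
  have "0 < coeff F (max m1 m2) + coeff G (max m1 m2)"
    using m1 m2 by (cases m1 m2 rule: linorder_cases) (auto simp: max_def)
  then show ?thesis unfolding less_transseries_def
    using m1(2) m2(2) by (intro exI[of _ "max m1 m2"]) auto
qed

lemma ts_not_less_self: "\<not> F < (F :: transseries)"
  unfolding less_transseries_def by simp

lemma ts_less_trans: "F < G \<Longrightarrow> G < H \<Longrightarrow> F < (H :: transseries)"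
  using ts_add_pos[of "G - F" "H - G"] ts_less_iff[of F G] ts_less_iff[of G H] ts_less_iff[of F H]
  by simp

lemma ts_less_total: "F < G \<or> F = G \<or> G < (F :: transseries)"
proof (cases "F = G")
  case False
  then have "G - F \<noteq> 0" by simp
  then obtain m where m: "coeff (G - F) m \<noteq> 0" "\<And>n. n > m \<Longrightarrow> coeff (G - F) n = 0"
    using ts_lead[of "G - F"] by blast
  then have "F < G \<or> G < F" unfolding less_transseries_def
    by (cases "coeff F m < coeff G m") (auto intro!: exI[of _ m])
  then show ?thesis by blast
qed simp

instance
proof
  fix F G H :: transseries
  show "(F < G) = (F \<le> G \<and> \<not> G \<le> F)"
    unfolding less_eq_transseries_def using ts_less_trans[of F G F] ts_not_less_self by auto
  show "F \<le> F" by (simp add: less_eq_transseries_def)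
  show "F \<le> H" if "F \<le> G" "G \<le> H"
    using that ts_less_trans unfolding less_eq_transseries_def by blast
  show "F = G" if "F \<le> G" "G \<le> F"
    using that ts_less_trans[of F G F] ts_not_less_self unfolding less_eq_transseries_def by auto
  show "F \<le> G \<or> G \<le> F"
    using ts_less_total unfolding less_eq_transseries_def by blast
  show "H + F \<le> H + G" if "F \<le> G"
    using that unfolding less_eq_transseries_def less_transseries_def by auto
  show "H * F < H * G" if "F < G" "0 < H"
    using that ts_mult_pos[of H "G - F"] ts_less_iff[of F G] ts_less_iff[of "H * F" "H * G"]
    by (simp add: algebra_simps)
  show "\<bar>F\<bar> = (if F < 0 then - F else F)" by (rule abs_transseries_def)
  show "sgn F = (if F = 0 then 0 else if 0 < F then 1 else - 1)" by (rule sgn_transseries_def)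
qed

end

lift_definition smon :: "real \<Rightarrow> monomial \<Rightarrow> transseries" is "\<lambda>c q p. c * single q p"
proof -
  fix c :: real and q :: monomial
  have s: "supp (\<lambda>p. c * single q p) \<subseteq> {q}" using supp_scale[of c "single q"] by simp
  obtain k h where "q \<in> mlevel k h" using mlevel_cover by blast
  then show "(\<exists>k h. supp (\<lambda>p. c * single q p) \<subseteq> mlevel k h) \<and> well_based (supp (\<lambda>p. c * single q p))"
    using s well_based_subset[OF well_based_finite s] by blast
qed

lemma coeff_smon: "coeff (smon c q) p = c * single q p"
  by (simp add: smon.rep_eq)

lemma coeff_mult_vanish:
  assumes "\<And>n. n > m \<Longrightarrow> coeff F n = 0" "\<And>n. n \<ge> p \<Longrightarrow> coeff D n = 0" "n \<ge> m * p"
  shows "coeff (F * D) n = 0"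
proof -
  have "\<And>n. n > p \<Longrightarrow> coeff D n = 0" using assms(2) by auto
  note l = coeff_mult_lead[OF assms(1) this]
  show ?thesis
  proof (cases "n = m * p")
    case True
    then show ?thesis using l(1) assms(2)[of p] by simp
  next
    case False
    then have "m * p < n" using assms(3) by simp
    then show ?thesis using coeff_mult_lead(2)[OF assms(1) \<open>\<And>n. n > p \<Longrightarrow> coeff D n = 0\<close>] by blast
  qed
qed

lemma ts_inverse_exists:
  assumes "F \<noteq> 0"
  shows "\<exists>G. F * G = (1 :: transseries)"
proof -
  obtain m0 where m0: "coeff F m0 \<noteq> 0" "\<And>n. n > m0 \<Longrightarrow> coeff F n = 0"
    using ts_lead[OF assms] by blast
  obtain k h where L: "supp (coeff F) \<subseteq> mlevel k h" using coeff_props(1) by blast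
  have m0L: "m0 \<in> mlevel k h" using L m0(1) by (auto simp: supp_def)
  define A where "A = {G. supp (coeff G) \<subseteq> mlevel k h \<and>
    (\<forall>p. coeff G p \<noteq> 0 \<longrightarrow> (\<forall>n\<ge>m0 * p. coeff (1 - F * G) n = 0))}"
  define P where "P = (\<lambda>G G'. \<forall>p. coeff G p \<noteq> 0 \<longrightarrow> (\<forall>q\<ge>p. coeff G' q = coeff G q))"
  have "partial_order_on A (relation_of P A)"
  proof (rule partial_order_on_relation_ofI)
    show "P G G" for G unfolding P_def by simp
    show "P G H" if "P G G'" "P G' H" for G G' H
      unfolding P_def
    proof (intro allI impI)
      fix p q assume p: "coeff G p \<noteq> 0" "p \<le> q"
      then have "coeff G' p \<noteq> 0" "coeff G' q = coeff G q" using that(1) unfolding P_def by auto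
      then show "coeff H q = coeff G q" using that(2) p unfolding P_def by auto
    qed
    show "G = H" if "P G H" "P H G" for G H
    proof (rule ts_eqI)
      fix m show "coeff G m = coeff H m"
        using that unfolding P_def by (cases "coeff G m = 0"; cases "coeff H m = 0") auto
    qed
  qed
  moreover have "\<exists>U\<in>A. \<forall>G\<in>C. P G U" if C: "C \<in> Chains (relation_of P A)" for C
  proof -
    have CA: "C \<subseteq> A" and tot: "\<And>G H. G \<in> C \<Longrightarrow> H \<in> C \<Longrightarrow> P G H \<or> P H G"
      using C unfolding Chains_def relation_of_def by auto
    define u where "u = (\<lambda>q. if \<exists>G\<in>C. coeff G q \<noteq> 0 then coeff (SOME G. G \<in> C \<and> coeff G q \<noteq> 0) q else 0)"
    have u: "u q = coeff G q" if "G \<in> C" "coeff G p \<noteq> 0" "q \<ge> p" for G p q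
    proof (cases "\<exists>G\<in>C. coeff G q \<noteq> 0")
      case False
      then show ?thesis using that unfolding u_def by auto
    next
      case True
      define H where "H = (SOME G. G \<in> C \<and> coeff G q \<noteq> 0)"
      have "H \<in> C \<and> coeff H q \<noteq> 0" unfolding H_def by (rule someI_ex) (use True in auto)
      moreover have "u q = coeff H q" using True unfolding u_def H_def by simp
      ultimately show ?thesis using tot[of G H] that unfolding P_def by auto
    qed
    have su: "\<exists>G\<in>C. coeff G q \<noteq> 0" if "u q \<noteq> 0" for q using that unfolding u_def by meson
    have L: "supp u \<subseteq> mlevel k h" using su CA unfolding A_def supp_def by blast
    have wb: "well_based (supp u)" unfolding well_based_def
    proof (intro allI impI)
      fix Y assume Y: "Y \<subseteq> supp u" "Y \<noteq> {}"
      then obtain p where p: "p \<in> Y" "u p \<noteq> 0" unfolding supp_def by auto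
      then obtain G where G: "G \<in> C" "coeff G p \<noteq> 0" using su by blast
      have "{q\<in>Y. q \<ge> p} \<subseteq> supp (coeff G)"
        using u[OF G] Y(1) unfolding supp_def by auto
      moreover have "{q\<in>Y. q \<ge> p} \<noteq> {}" using p by auto
      ultimately obtain m where m: "m \<in> {q\<in>Y. q \<ge> p}" "\<forall>n\<in>{q\<in>Y. q \<ge> p}. n \<le> m"
        using coeff_props(2)[of G] unfolding well_based_def by meson
      then have "\<forall>n\<in>Y. n \<le> m" by (metis (mono_tags, lifting) linear mem_Collect_eq order_trans)
      then show "\<exists>m\<in>Y. \<forall>n\<in>Y. n \<le> m" using m by blast
    qed
    define U where "U = abs_ts u"
    have cU: "coeff U = u" unfolding U_def by (rule coeff_abs[OF L wb])
    have PU: "P G U" if "G \<in> C" for G unfolding P_def cU using u[OF that] by auto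
    have "coeff (1 - F * U) n = 0" if p: "coeff U p \<noteq> 0" "n \<ge> m0 * p" for p n
    proof -
      obtain G where G: "G \<in> C" "coeff G p \<noteq> 0" using su p(1) cU by auto
      have "\<And>q. q \<ge> p \<Longrightarrow> coeff (U - G) q = 0" using u[OF G] cU by simp
      then have 1: "coeff (F * (U - G)) n = 0" using coeff_mult_vanish[OF m0(2)] p(2) by blast
      have 2: "coeff (1 - F * G) n = 0" using G CA p(2) unfolding A_def by blast
      have "1 - F * U = (1 - F * G) - F * (U - G)" by (simp add: algebra_simps)
      then show ?thesis using 1 2 by (metis coeff_simps(4) diff_zero)
    qed
    then have "U \<in> A" unfolding A_def using L cU by auto
    then show ?thesis using PU by blast
  qed
  ultimately obtain G where G: "G \<in> A" and max: "\<And>G'. G' \<in> A \<Longrightarrow> P G G' \<Longrightarrow> G' = G"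
    using predicate_Zorn[of A P] by blast
  define R where "R = 1 - F * G"
  have "R = 0"
  proof (rule ccontr)
    assume "R \<noteq> 0"
    then obtain n where n: "coeff R n \<noteq> 0" "\<And>n'. n' > n \<Longrightarrow> coeff R n' = 0" using ts_lead by blast
    have GL: "supp (coeff G) \<subseteq> mlevel k h" using G unfolding A_def by blast
    have "supp (coeff (F * G)) \<subseteq> mlevel k h"
      unfolding coeff_mult using supp_conv mprod_mlevel[OF L GL] by (rule subset_trans)
    moreover have "coeff (F * G) n \<noteq> 0 \<or> n = 1"
      using n(1) unfolding R_def by (auto simp: coeff_one single_def split: if_splits)
    ultimately have nL: "n \<in> mlevel k h" using mlevel_one unfolding supp_def by auto
    define q0 where "q0 = inverse m0 * n"
    have q0: "m0 * q0 = n" unfolding q0_def by (simp add: mult.assoc[symmetric])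
    have q0L: "q0 \<in> mlevel k h" unfolding q0_def by (intro mlevel_mult mlevel_inverse m0L nL)
    define c where "c = coeff R n / coeff F m0"
    have c: "c \<noteq> 0" "coeff F m0 * c = coeff R n" unfolding c_def using n m0 by auto
    define D where "D = smon c q0"
    have D: "coeff D q = (if q = q0 then c else 0)" for q
      unfolding D_def coeff_smon by (auto simp: single_def)
    have D0: "\<And>q. q > q0 \<Longrightarrow> coeff D q = 0" by (auto simp: D)
    have FD: "coeff (F * D) n = coeff R n" "\<And>n'. n' > n \<Longrightarrow> coeff (F * D) n' = 0"
      using coeff_mult_lead[of m0 F q0 D, OF m0(2) D0] c(2) unfolding q0 by (simp_all add: D)
    have below: "q0 < p" if "coeff G p \<noteq> 0" for p
    proof (rule ccontr)
      assume "\<not> q0 < p"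
      then have "m0 * p \<le> n" unfolding q0[symmetric] by simp
      then show False using G that n(1) unfolding A_def R_def by blast
    qed
    have R': "1 - F * (G + D) = R - F * D" unfolding R_def by (simp add: algebra_simps)
    have "G + D \<in> A" unfolding A_def
    proof (intro CollectI conjI allI impI)
      show "supp (coeff (G + D)) \<subseteq> mlevel k h"
        using GL q0L by (auto simp: supp_def D split: if_splits)
      fix p n' assume p: "coeff (G + D) p \<noteq> 0" "n' \<ge> m0 * p"
      have "n \<le> n'"
      proof (cases "p = q0")
        case True
        then show ?thesis using p q0 by simp
      next
        case False
        then have "q0 \<le> p" using p(1) below[of p] by (simp add: D)
        then have "m0 * q0 \<le> m0 * p" by simp
        then show ?thesis using p(2) q0 by simp
      qed
      then show "coeff (1 - F * (G + D)) n' = 0"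
        unfolding R' using FD n(2)[of n'] by (cases "n' = n") auto
    qed
    moreover have "P G (G + D)" unfolding P_def
      using below by (auto simp: D dest: leD)
    ultimately have "G + D = G" by (rule max)
    then have "D = 0" by simp
    then show False using D[of q0] c(1) by simp
  qed
  then show ?thesis unfolding R_def by (intro exI[of _ G]) simp
qed

instantiation transseries :: inverse
begin

definition inverse_transseries :: "transseries \<Rightarrow> transseries" where
  "inverse F = (if F = 0 then 0 else THE G. F * G = (1 :: transseries))"

definition divide_transseries :: "transseries \<Rightarrow> transseries \<Rightarrow> transseries" where
  "F div G = F * inverse (G :: transseries)"

instance ..

end

instance transseries :: field
proof
  fix F G :: transseries
  show "inverse F * F = 1" if "F \<noteq> 0"
  proof -
    have "\<exists>!G. F * G = 1"
      using ts_inverse_exists[OF that] that by (metis mult_cancel_left)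
    then have "F * (THE G. F * G = 1) = 1" by (rule theI')
    then show ?thesis using that unfolding inverse_transseries_def by (simp add: mult.commute)
  qed
  show "F / G = F * inverse G" by (rule divide_transseries_def)
  show "inverse (0 :: transseries) = 0" by (simp add: inverse_transseries_def)
qed

instance transseries :: linordered_field ..

instantiation transseries :: scaleR
begin

lift_definition scaleR_transseries :: "real \<Rightarrow> transseries \<Rightarrow> transseries" is "\<lambda>r f m. r * f m"
proof -
  fix r :: real and f :: "monomial \<Rightarrow> real"
  assume "(\<exists>k h. supp f \<subseteq> mlevel k h) \<and> well_based (supp f)"
  then show "(\<exists>k h. supp (\<lambda>m. r * f m) \<subseteq> mlevel k h) \<and> well_based (supp (\<lambda>m. r * f m))"
    using supp_scale[of r f] well_based_subset[OF _ supp_scale[of r f]] by (meson subset_trans)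
qed

lemma coeff_scaleR [simp]: "coeff (r *\<^sub>R F) m = r * coeff F m"
  by (simp add: scaleR_transseries.rep_eq)

instance ..

end

instance transseries :: real_field
proof
  fix a b :: real and F G :: transseries
  show "a *\<^sub>R (F + G) = a *\<^sub>R F + a *\<^sub>R G" by (rule ts_eqI) (simp add: algebra_simps)
  show "(a + b) *\<^sub>R F = a *\<^sub>R F + b *\<^sub>R F" by (rule ts_eqI) (simp add: algebra_simps)
  show "a *\<^sub>R b *\<^sub>R F = (a * b) *\<^sub>R F" by (rule ts_eqI) (simp add: algebra_simps)
  show "1 *\<^sub>R F = F" by (rule ts_eqI) simp
  show l: "a *\<^sub>R F * G = a *\<^sub>R (F * G)" for F G :: transseries
  proof (rule ts_eqI)
    fix m
    note wb = coeff_props(2)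
    have "coeff (a *\<^sub>R F * G) m = (\<Sum>(p, q) \<in> cpairs (supp (coeff F)) (supp (coeff G)) m. coeff (a *\<^sub>R F) p * coeff G q)"
      by (rule coeff_mult_superset[OF _ order_refl wb wb]) (auto simp: supp_def)
    then show "coeff (a *\<^sub>R F * G) m = coeff (a *\<^sub>R (F * G)) m"
      unfolding coeff_scaleR coeff_mult_superset[OF order_refl order_refl wb wb]
      by (simp add: sum_distrib_left case_prod_unfold mult.assoc)
  qed
  show "F * a *\<^sub>R G = a *\<^sub>R (F * G)" using l[of G F] by (simp add: mult.commute)
qed

definition of_mon :: "monomial \<Rightarrow> transseries" where "of_mon m = smon 1 m"

lemma coeff_of_mon: "coeff (of_mon m) = single m"
  by (rule ext) (simp add: of_mon_def coeff_smon)

lemma coeff_mult_of_mon: "coeff (of_mon h * F) (h * m) = coeff F m"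
proof -
  have w: "well_based {h}" by (rule well_based_finite) simp
  have "coeff (of_mon h * F) (h * m) = (\<Sum>(p, q) \<in> cpairs {h} (supp (coeff F)) (h * m). coeff (of_mon h) p * coeff F q)"
    by (rule coeff_mult_superset) (use w coeff_props(2) in \<open>auto simp: coeff_of_mon\<close>)
  also have "cpairs {h} (supp (coeff F)) (h * m) = (if coeff F m = 0 then {} else {(h, m)})"
    by (auto simp: cpairs_def supp_def)
  also have "(\<Sum>(p, q) \<in> (if coeff F m = 0 then {} else {(h, m)}). coeff (of_mon h) p * coeff F q) = coeff F m"
    by (simp add: coeff_of_mon)
  finally show ?thesis .
qed

lemma of_mon_inject [simp]: "of_mon m = of_mon n \<longleftrightarrow> m = n"
  by (metis coeff_of_mon single_def zero_neq_one)

lemma of_mon_mult: "of_mon (m * n) = of_mon m * of_mon n"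
proof (rule ts_eqI)
  fix p
  have "p = m * (inverse m * p)" by (simp add: mult.assoc[symmetric])
  then have "coeff (of_mon m * of_mon n) p = single n (inverse m * p)"
    using coeff_mult_of_mon[of m "of_mon n" "inverse m * p"] by (simp add: coeff_of_mon)
  also have "\<dots> = single (m * n) p"
    unfolding single_def by (metis mon_left_inverse mon_right_inverse mult.assoc mult_1)
  finally show "coeff (of_mon (m * n)) p = coeff (of_mon m * of_mon n) p" by (simp add: coeff_of_mon)
qed

lemma of_mon_one: "of_mon 1 = 1"
  by (rule ts_eqI) (simp add: coeff_of_mon coeff_one)

lemma of_mon_nonzero: "of_mon m \<noteq> 0"
  by (metis coeff_of_mon coeff_simps(1) single_simps(1) zero_neq_one)

lemma of_mon_inverse: "of_mon (inverse m) = inverse (of_mon m)"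
  by (metis inverse_unique mon_right_inverse of_mon_mult of_mon_one)

text \<open>\<open>exp_up\<close> is the exponential of \<open>T\<close> on purely infinite series, where its values are monomials.\<close>

definition purely_infinite :: "transseries \<Rightarrow> bool" where
  "purely_infinite F \<longleftrightarrow> (\<forall>m. coeff F m \<noteq> 0 \<longrightarrow> 1 < m)"

definition raw :: "transseries \<Rightarrow> pmono \<Rightarrow> real" where
  "raw F p = (if p \<in> mons then coeff F (abs_mon p) else 0)"

definition exp_up :: "transseries \<Rightarrow> transseries" where
  "exp_up F = of_mon (abs_mon (pexp (raw F)))"

lemma supp_raw: "supp (raw F) = rep_mon ` supp (coeff F)"
proof
  show "supp (raw F) \<subseteq> rep_mon ` supp (coeff F)"
    unfolding supp_def raw_def by (auto simp: image_iff split: if_splits) (metis abs_mon_inverse)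
  show "rep_mon ` supp (coeff F) \<subseteq> supp (raw F)"
    unfolding supp_def raw_def by (auto simp: rep_mon rep_mon_inverse)
qed

lemma raw_add: "raw (F + G) = (\<lambda>p. raw F p + raw G p)"
  by (auto simp: raw_def)

lemma raw_up:
  assumes "purely_infinite F" "supp (coeff F) \<subseteq> mlevel k h"
  shows "raw F \<in> hahn_up (level k h)"
proof -
  have "supp (raw F) \<subseteq> level k h" using assms(2) unfolding supp_raw mlevel_def by blast
  moreover have "rwo pless (supp (raw F))" unfolding wo_def supp_raw
  proof (intro allI impI)
    fix Y assume Y: "Y \<subseteq> rep_mon ` supp (coeff F)" "Y \<noteq> {}"
    then obtain Z where Z: "Z \<subseteq> supp (coeff F)" "Y = rep_mon ` Z" by (metis subset_imageE)
    then obtain m where m: "m \<in> Z" "\<And>n. n \<in> Z \<Longrightarrow> n \<le> m"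
      using coeff_props(2)[of F, unfolded well_based_def, rule_format, OF Z(1)] Y(2) by auto
    have "pless (rep_mon n) (rep_mon m)" if "n \<in> Z" "rep_mon n \<noteq> rep_mon m" for n
      using m(2)[OF that(1)] that(2) unfolding less_eq_monomial_def less_monomial_def by auto
    then show "\<exists>y\<in>Y. \<forall>z\<in>Y. z \<noteq> y \<longrightarrow> pless z y" unfolding Z(2) using m(1) by blast
  qed
  moreover have "pless (pexp (\<lambda>_. 0)) p" if p: "p \<in> supp (raw F)" for p
  proof -
    obtain m where m: "p = rep_mon m" "coeff F m \<noteq> 0" using p unfolding supp_raw by (auto simp: supp_def)
    then have "1 < m" using assms(1) unfolding purely_infinite_def by blast
    then show ?thesis unfolding less_monomial_def one_monomial_def m(1) using mons_one
      by (simp add: abs_mon_inverse)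
  qed
  ultimately show ?thesis unfolding hahn_up_def hahn_def by blast
qed

lemma exp_up_level:
  assumes "purely_infinite F" "supp (coeff F) \<subseteq> mlevel k h"
  shows "pexp (raw F) \<in> level k (Suc h)" "plog (pexp (raw F)) = raw F"
proof -
  have r: "raw F = (\<lambda>p. 0 * single (Lg (Suc k)) p + raw F p)" by simp
  show "pexp (raw F) \<in> level k (Suc h)"
    unfolding level.simps(2) mem_Collect_eq using raw_up[OF assms]
    by (intro exI[of _ 0] exI[of _ "raw F"]) simp
  show "plog (pexp (raw F)) = raw F"
    using plog_level_Suc[OF raw_up[OF assms], of 0] by simp
qed

lemma exp_up_props:
  assumes "purely_infinite F" "supp (coeff F) \<subseteq> mlevel k h"
  obtains m where "exp_up F = of_mon m" "mlog m = raw F" "m \<in> mlevel k (Suc h)"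
proof -
  have "pexp (raw F) \<in> mons" using exp_up_level(1)[OF assms] unfolding mons_def by blast
  then have r: "rep_mon (abs_mon (pexp (raw F))) = pexp (raw F)" by (rule abs_mon_inverse)
  show ?thesis
    by (rule that[of "abs_mon (pexp (raw F))"])
       (use exp_up_level[OF assms] in \<open>auto simp: exp_up_def r mlevel_def\<close>)
qed

lemma purely_infinite_add: "purely_infinite F \<Longrightarrow> purely_infinite G \<Longrightarrow> purely_infinite (F + G)"
  unfolding purely_infinite_def by (metis add.right_neutral coeff_simps(2) )

lemma exp_up_add:
  assumes "purely_infinite F" "purely_infinite G"
  shows "exp_up (F + G) = exp_up F * exp_up G"
proof -
  obtain k h where "supp (coeff F) \<subseteq> mlevel k h" "supp (coeff G) \<subseteq> mlevel k h"
    using common_level by blast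
  moreover from this have "supp (coeff (F + G)) \<subseteq> mlevel k h"
    using supp_add[of "coeff F" "coeff G"] by (simp add: supp_def) blast
  ultimately obtain m n p where "exp_up F = of_mon m" "mlog m = raw F" "exp_up G = of_mon n" "mlog n = raw G"
     "exp_up (F + G) = of_mon p" "mlog p = raw (F + G)"
    using exp_up_props assms purely_infinite_add by metis
  moreover from this have "p = m * n"
    by (intro mlog_inject) (simp add: mlog_mult raw_add)
  ultimately show ?thesis by (simp add: of_mon_mult)
qed

lemma of_mon_less [simp]: "of_mon m < of_mon n \<longleftrightarrow> m < n"
proof -
  have "of_mon m < of_mon n" if "m < n" for m n
    unfolding less_transseries_def coeff_of_mon using that
    by (intro exI[of _ n]) (auto simp: single_def)
  then show ?thesis by (metis less_asym linorder_neqE)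
qed

lemma exp_up_less:
  assumes "purely_infinite F" "purely_infinite G" "F < G"
  shows "exp_up F < exp_up G"
proof -
  obtain k h where "supp (coeff F) \<subseteq> mlevel k h" "supp (coeff G) \<subseteq> mlevel k h"
    using common_level by blast
  then obtain m n where mn: "exp_up F = of_mon m" "mlog m = raw F" "exp_up G = of_mon n" "mlog n = raw G"
    using exp_up_props assms by metis
  obtain p where p: "coeff F p < coeff G p" "\<And>q. q > p \<Longrightarrow> coeff F q = coeff G q"
    using assms(3) unfolding less_transseries_def by blast
  have "pless q (rep_mon p)" if q: "q \<noteq> rep_mon p" "raw G q - raw F q \<noteq> 0" for q
  proof -
    have qm: "q \<in> mons" using q(2) by (auto simp: raw_def split: if_splits)
    then have "coeff F (abs_mon q) \<noteq> coeff G (abs_mon q)" using q(2) by (simp add: raw_def)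
    then have "abs_mon q \<le> p" using p(2)[of "abs_mon q"] by (meson not_le)
    moreover have "abs_mon q \<noteq> p" using q(1) qm by (auto simp: abs_mon_inverse)
    ultimately show ?thesis using qm by (auto simp: less_eq_monomial_def less_monomial_def abs_mon_inverse)
  qed
  moreover have "raw G (rep_mon p) - raw F (rep_mon p) > 0"
    using p(1) by (simp add: raw_def rep_mon rep_mon_inverse)
  ultimately have "m < n"
    unfolding less_monomial_def pless_iff[of "rep_mon m"] mn pos_def by blast
  then show ?thesis unfolding mn by simp
qed

definition ell :: "nat \<Rightarrow> transseries" where "ell k = of_mon (abs_mon (Lg k))"

lemma exp_up_log: "exp_up (ell (Suc k)) = ell k"
proof -
  have "raw (ell (Suc k)) = single (Lg (Suc k))"
    unfolding raw_def ell_def coeff_of_mon single_def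
    using mons_Lg by (auto simp: fun_eq_iff abs_mon_inject)
  then show ?thesis unfolding exp_up_def ell_def by simp
qed

lemma lg_level: "abs_mon (Lg k) \<in> mlevel k 0"
proof -
  have "Lg k = pexp (\<lambda>p. 1 * single (Lg (Suc k)) p)" by simp
  then have "Lg k \<in> level k 0" unfolding level.simps by blast
  then show ?thesis unfolding mlevel_def using mons_Lg by (simp add: abs_mon_inverse)
qed

lemma one_less_lg: "1 < abs_mon (Lg k)"
  unfolding less_monomial_def one_monomial_def
  using mons_Lg mons_one
  by (auto simp: abs_mon_inverse pless_iff[of "pexp (\<lambda>_. 0)"] plog_pexp pos_def single_def)

abbreviation "ts_x \<equiv> ell 0"
abbreviation "ts_logx \<equiv> ell 1"

text \<open>Hahn series over a set \<open>S\<close> of monomials, taken inside \<open>T\<close>.  For the groups \<open>ts_G n\<close> below this is the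
full Hahn field, see lemma \<open>hahn_over_ts_G_full\<close>.\<close>

definition hahn_over :: "transseries set \<Rightarrow> transseries set" where
  "hahn_over S = {F. \<forall>m. coeff F m \<noteq> 0 \<longrightarrow> of_mon m \<in> S}"

text \<open>The factor \<open>x\<close> to the power \<open>\<theta> + k\<close> is \<open>exp((\<theta> + k) log x)\<close>; its exponent \<open>(\<theta> + k) log x\<close> is purely
infinite.\<close>

primrec ts_G :: "nat \<Rightarrow> transseries set" where
  "ts_G 0 = {ts_x powi k | k. True}"
| "ts_G (Suc n) = {exp_up \<gamma> * exp_up ((\<theta> + of_int k) * ts_logx) | \<gamma> \<theta> k.
     \<gamma> \<in> hahn_over (ts_G n) \<and> purely_infinite \<gamma> \<and> \<theta> \<in> hahn_over (ts_G n) \<and> purely_infinite \<theta>}"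

lemma mlevel_mono: "h \<le> h' \<Longrightarrow> mlevel k h \<subseteq> mlevel k h'"
  unfolding mlevel_def using level_mono by blast

lemma coeff_of_int: "coeff (of_int k) m = (if m = 1 then of_int k else 0)"
proof -
  have "(of_int k :: transseries) = of_int k *\<^sub>R 1" 
    by (metis of_real_def of_real_of_int_eq)
  then show ?thesis by (simp add: coeff_one single_def)
qed

lemma ts_G_level: "ts_G n \<subseteq> of_mon ` mlevel 1 (Suc n)"
proof (induction n)
  case 0
  define m0 where "m0 = abs_mon (Lg 0)"
  have m0: "m0 \<in> mlevel 1 1"
    using lg_level[of 0] level_lift[of 0 0] unfolding m0_def mlevel_def by auto
  have pw: "ts_x ^ i \<in> of_mon ` mlevel 1 1" for i
  proof (induction i)
    case 0
    then show ?case using mlevel_one of_mon_one by (metis image_eqI power_0)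
  next
    case (Suc i)
    then obtain m where "m \<in> mlevel 1 1" "ts_x ^ i = of_mon m" by blast
    then have "ts_x ^ Suc i = of_mon (m0 * m)" "m0 * m \<in> mlevel 1 1"
      using mlevel_mult[OF m0] by (auto simp: of_mon_mult ell_def m0_def)
    then show ?case by blast
  qed
  have "inverse F \<in> of_mon ` mlevel 1 1" if "F \<in> of_mon ` mlevel 1 1" for F
    using that mlevel_inverse of_mon_inverse by (metis (no_types, lifting) image_iff)
  then have "ts_x powi k \<in> of_mon ` mlevel 1 1" for k
    using pw unfolding power_int_def power_inverse by presburger
  then show ?case by auto
next
  case (Suc n)
  show ?case
  proof
    fix F assume "F \<in> ts_G (Suc n)"
    then obtain \<gamma> \<theta> k where F: "F = exp_up \<gamma> * exp_up ((\<theta> + of_int k) * ts_logx)"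
      and g: "\<gamma> \<in> hahn_over (ts_G n)" "purely_infinite \<gamma>" and t: "\<theta> \<in> hahn_over (ts_G n)" "purely_infinite \<theta>"
      by auto
    have sub: "supp (coeff H) \<subseteq> mlevel 1 (Suc n)" if "H \<in> hahn_over (ts_G n)" for H
      using that Suc unfolding hahn_over_def supp_def by force
    define E where "E = \<theta> + of_int k"
    have E: "supp (coeff E) \<subseteq> mlevel 1 (Suc n)" "\<And>m. m \<in> supp (coeff E) \<Longrightarrow> 1 \<le> m"
      using sub[OF t(1)] t(2) mlevel_one unfolding E_def purely_infinite_def
      by (auto simp: supp_def coeff_of_int split: if_splits)
    define l where "l = abs_mon (Lg 1)"
    have l: "l \<in> mlevel 1 (Suc n)" "1 < l"
      using lg_level[of 1] mlevel_mono[of 0 "Suc n" 1] one_less_lg unfolding l_def by auto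
    have s: "supp (coeff (E * ts_logx)) \<subseteq> mprod (supp (coeff E)) {l}"
      using supp_conv[of "coeff E" "coeff ts_logx"] unfolding coeff_mult ell_def coeff_of_mon l_def by simp
    have s1: "supp (coeff (E * ts_logx)) \<subseteq> mlevel 1 (Suc n)"
      using s mprod_mlevel[OF E(1), of "{l}"] l(1) by blast
    have "1 < m" if m: "m \<in> supp (coeff (E * ts_logx))" for m
    proof -
      obtain e where e: "e \<in> supp (coeff E)" "m = e * l" using s m unfolding mprod_def by blast
      then show ?thesis using mon_mult_less[of 1 l 1 e] E(2)[OF e(1)] l(2) by (simp add: mult.commute)
    qed
    then have s2: "purely_infinite (E * ts_logx)" unfolding purely_infinite_def supp_def by blast
    obtain m where m: "exp_up \<gamma> = of_mon m" "m \<in> mlevel 1 (Suc (Suc n))"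
      using exp_up_props[OF g(2) sub[OF g(1)]] by metis
    obtain m' where m': "exp_up (E * ts_logx) = of_mon m'" "m' \<in> mlevel 1 (Suc (Suc n))"
      using exp_up_props[OF s2 s1] by metis
    show "F \<in> of_mon ` mlevel 1 (Suc (Suc n))"
      unfolding F E_def[symmetric] m(1) m'(1) of_mon_mult[symmetric] using mlevel_mult m(2) m'(2) by blast
  qed
qed

lemma hahn_over_ts_G_full:
  assumes "well_based (supp f)" "of_mon ` supp f \<subseteq> ts_G n"
  shows "\<exists>F \<in> hahn_over (ts_G n). coeff F = f"
proof -
  have "supp f \<subseteq> mlevel 1 (Suc n)" using assms(2) ts_G_level[of n] by force
  from coeff_abs[OF this assms(1)] show ?thesis
    using assms(2) unfolding hahn_over_def supp_def by (intro bexI[of _ "abs_ts f"]) auto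
qed

definition ts_K :: "transseries set" where "ts_K = (\<Union>n. hahn_over (ts_G n))"

definition ts_H :: "transseries set" where "ts_H = {a + b * ts_logx | a b. a \<in> ts_K \<and> b \<in> ts_K}"

definition ts_bigo where "ts_bigo u v \<longleftrightarrow> (\<exists>C>0. \<bar>u\<bar> \<le> of_real C * \<bar>v :: transseries\<bar>)"
definition ts_smallo where "ts_smallo u v \<longleftrightarrow> (\<forall>\<epsilon>>0. \<bar>u\<bar> < of_real \<epsilon> * \<bar>v :: transseries\<bar>)"
definition ts_infinite :: "transseries \<Rightarrow> bool" where "ts_infinite F \<longleftrightarrow> (\<forall>r. of_real r < \<bar>F\<bar>)"

definition tr_above :: "transseries \<Rightarrow> transseries \<Rightarrow> transseries" where
  "tr_above s F = abs_ts (\<lambda>m. if ts_infinite (of_mon m / s) then coeff F m else 0)"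

lemma coeff_tr_above: "coeff (tr_above s F) m = (if ts_infinite (of_mon m / s) then coeff F m else 0)"
proof -
  obtain k h where L: "supp (coeff F) \<subseteq> mlevel k h" using coeff_props(1) by blast
  have s: "supp (\<lambda>m. if ts_infinite (of_mon m / s) then coeff F m else 0) \<subseteq> supp (coeff F)"
    by (auto simp: supp_def)
  show ?thesis unfolding tr_above_def
    by (subst coeff_abs[OF subset_trans[OF s L] well_based_subset[OF coeff_props(2) s]]) simp
qed

end

theory Submission
  imports Defs
begin

text \<open>Let \<open>d\<close> be the leading monomial of \<open>s > 0\<close>.  Real multiples of \<open>s\<close> and of \<open>d\<close> bound each other,
and distinct monomials lie in distinct Archimedean classes, so \<open>m / s\<close> is infinite exactly when
\<open>m > d\<close> (\<open>infinite_div_iff\<close>).  Hence \<open>tr_above s\<close> is the cut of the Hahn expansion at \<open>d\<close>.  Likewise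
\<open>F = O(s)\<close> holds exactly when the support of \<open>F\<close> has no monomial above \<open>d\<close> (\<open>bigo_iff_supp_le\<close>).
In other words, \<open>O(s)\<close> is the kernel of the cut, which settles the statements about \<open>O(s)\<close>.
If \<open>s\<close> is the monomial \<open>d\<close> itself, removing the term at \<open>d\<close> as well leaves a series supported strictly
below \<open>s\<close>, which is \<open>o(s)\<close>.

The cut is weakly increasing because the order is lexicographic: two series are compared at the
largest monomial where they differ, and the cut either keeps this monomial or makes the two equal.

\<open>K\<close> is preserved since it is a union of full Hahn fields, which are closed under restricting the
support.  Multiplication by a monomial \<open>h\<close> translates supports and the cut alike, whence
\<open>tr_above (h s) (h F) = h tr_above s F\<close>.  As \<open>log x\<close> is a monomial, this gives
\<open>tr_above s (b log x) = tr_above (s / log x) b log x\<close>, so that \<open>K + K log x\<close> is preserved because \<open>K\<close> is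
preserved at every threshold.\<close>

abbreviation supp_le :: "transseries \<Rightarrow> monomial \<Rightarrow> bool" where
  "supp_le F d \<equiv> \<forall>n>d. coeff F n = 0"

lemma coeff_of_real_mult: "coeff (of_real r * F) m = r * coeff F m"
  by (simp flip: scaleR_conv_of_real)

lemma pos_leading_monomial:
  assumes "0 < s"
  obtains d where "0 < coeff s d" "supp_le s d"
  using assms unfolding less_transseries_def by auto

text \<open>Both \<open>F\<close> and \<open>- F\<close> agree with \<open>G\<close> above \<open>d\<close> and have the smaller coefficient at \<open>d\<close>.  With
\<open>G = C s\<close> this yields the \<open>O\<close> estimate for a large \<open>C\<close>, and the \<open>o\<close> estimate for every \<open>C > 0\<close> if
\<open>coeff F d = 0\<close>.\<close>

lemma abs_less_by_coeff:
  assumes "supp_le F d" "supp_le G d" "\<bar>coeff F d\<bar> < coeff G d"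
  shows "\<bar>F\<bar> < G"
proof -
  have "F < G" "- F < G"
    unfolding less_transseries_def using assms by (auto intro!: exI[of _ d])
  then show ?thesis by (simp add: abs_less_iff)
qed

lemma less_abs_by_coeff:
  assumes "supp_le F d" "supp_le G d" "\<bar>coeff F d\<bar> < \<bar>coeff G d\<bar>"
  shows "F < \<bar>G\<bar>"
proof (cases "0 < coeff G d")
  case True
  then have "F < G" unfolding less_transseries_def using assms by (auto intro!: exI[of _ d])
  then show ?thesis by (simp add: less_le_trans[OF _ abs_ge_self])
next
  case False
  then have "F < - G" unfolding less_transseries_def using assms by (auto intro!: exI[of _ d])
  then show ?thesis by (simp add: less_le_trans[OF _ abs_ge_minus_self])
qed

lemma bigo_iff_supp_le:
  assumes "0 < s" "0 < coeff s d" "supp_le s d"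
  shows "ts_bigo F s \<longleftrightarrow> supp_le F d"
proof
  assume "supp_le F d"
  \<comment> \<open>\<open>C\<close> is chosen so that the coefficient of \<open>C s\<close> at \<open>d\<close> strictly exceeds that of \<open>\<bar>F\<bar>\<close>.\<close>
  define C where "C = (\<bar>coeff F d\<bar> + 1) / coeff s d"
  have "C * coeff s d = \<bar>coeff F d\<bar> + 1" using assms(2) by (simp add: C_def)
  then have "\<bar>F\<bar> < of_real C * s"
    using assms(3) \<open>supp_le F d\<close>
    by (intro abs_less_by_coeff[where d = d]) (auto simp: coeff_of_real_mult)
  moreover have "C > 0" using assms(2) by (simp add: C_def add_nonneg_pos)
  ultimately show "ts_bigo F s" unfolding ts_bigo_def using assms(1) by (auto intro!: exI[of _ C])
next
  assume "ts_bigo F s"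
  then obtain C where C: "\<bar>F\<bar> \<le> of_real C * s"
    unfolding ts_bigo_def using assms(1) by auto
  show "supp_le F d"
  proof (rule ccontr)
    assume not_le: "\<not> supp_le F d"
    then have "F \<noteq> 0" by auto
    then obtain m where m: "coeff F m \<noteq> 0" "supp_le F m" using ts_lead by blast
    then have "d < m" using not_le by (meson less_le_trans not_le_imp_less)
    then have "of_real C * s < \<bar>F\<bar>"
      using assms(3) m by (intro less_abs_by_coeff[where d = m]) (auto simp: coeff_of_real_mult)
    then show False using C by simp
  qed
qed

lemma smallo_if_supp_less:
  assumes "0 < s" "0 < coeff s d" "supp_le s d" "supp_le F d" "coeff F d = 0"
  shows "ts_smallo F s"
  unfolding ts_smallo_def
  using assms by (auto intro!: abs_less_by_coeff[where d = d] simp: coeff_of_real_mult)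

lemma infinite_div_iff:
  assumes "0 < s" "0 < coeff s d" "supp_le s d"
  shows "ts_infinite (of_mon m / s) \<longleftrightarrow> d < m"
proof -
  have "0 < of_mon m"
    unfolding less_transseries_def coeff_of_mon by (auto intro!: exI[of _ m] simp: single_def)
  then have inf_iff: "ts_infinite (of_mon m / s) \<longleftrightarrow> (\<forall>r. of_real r * s < of_mon m)"
    unfolding ts_infinite_def using assms(1) by (simp add: pos_less_divide_eq)
  show ?thesis
  proof
    assume "d < m"
    then have "of_real r * s < of_mon m" for r
      unfolding less_transseries_def coeff_of_real_mult coeff_of_mon
      using assms(3) by (auto intro!: exI[of _ m] simp: single_def)
    then show "ts_infinite (of_mon m / s)" using inf_iff by blast
  next
    assume inf: "ts_infinite (of_mon m / s)"
    show "d < m"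
    proof (rule ccontr)
      assume "\<not> d < m"
      \<comment> \<open>The coefficient of \<open>m\<close> at \<open>d\<close> is at most \<open>1\<close>, and that of \<open>(2 / coeff s d) s\<close> is \<open>2\<close>.\<close>
      then have "\<bar>of_mon m\<bar> < of_real (2 / coeff s d) * s"
        using assms(2,3)
        by (intro abs_less_by_coeff[where d = d])
           (auto simp: coeff_of_real_mult coeff_of_mon single_def simp del: of_real_divide)
      then show False using inf inf_iff by (meson abs_ge_self less_asym le_less_trans)
    qed
  qed
qed

lemma coeff_tr_above_leading:
  assumes "0 < s" "0 < coeff s d" "supp_le s d"
  shows "coeff (tr_above s F) m = (if d < m then coeff F m else 0)"
  using infinite_div_iff[OF assms] by (simp add: coeff_tr_above)

lemma linear_tr_above: "linear (tr_above s)"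
  by (rule linearI) (auto intro!: ts_eqI simp: coeff_tr_above)

lemma mono_tr_above:
  assumes "0 < s"
  shows "mono (tr_above s)"
proof (rule monoI)
  fix F G :: transseries
  assume "F \<le> G"
  obtain d where d: "0 < coeff s d" "supp_le s d" using pos_leading_monomial[OF assms] .
  note tr = coeff_tr_above_leading[OF assms d]
  show "tr_above s F \<le> tr_above s G"
  proof (cases "F = G")
    case False
    then obtain m where m: "coeff F m < coeff G m" "\<And>n. n > m \<Longrightarrow> coeff F n = coeff G n"
      using \<open>F \<le> G\<close> unfolding less_eq_transseries_def less_transseries_def by blast
    show ?thesis
    proof (cases "d < m")
      case True
      then have "tr_above s F < tr_above s G"
        unfolding less_transseries_def tr using m by (auto intro!: exI[of _ m])
      then show ?thesis by simp
    next
      case False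
      then have "tr_above s F = tr_above s G"
        using m(2) by (intro ts_eqI) (auto simp: tr)
      then show ?thesis by simp
    qed
  qed simp
qed

lemma tr_above_in_ts_K: "F \<in> ts_K \<Longrightarrow> tr_above s F \<in> ts_K"
  unfolding ts_K_def hahn_over_def by (auto simp: coeff_tr_above split: if_splits)

lemma tr_above_of_mon_mult: "tr_above (of_mon h * s) (of_mon h * F) = of_mon h * tr_above s F"
proof (rule ts_eqI)
  fix n
  define m where "m = inverse h * n"
  have n: "n = h * m" unfolding m_def by (simp flip: mult.assoc)
  have "of_mon (h * m) / (of_mon h * s) = of_mon m / s"
    by (simp add: of_mon_mult of_mon_nonzero)
  then show "coeff (tr_above (of_mon h * s) (of_mon h * F)) n = coeff (of_mon h * tr_above s F) n"
    unfolding n by (simp add: coeff_tr_above coeff_mult_of_mon)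
qed

lemma tr_above_in_ts_H:
  assumes "F \<in> ts_H"
  shows "tr_above s F \<in> ts_H"
proof -
  obtain a b where F: "F = a + b * ts_logx" "a \<in> ts_K" "b \<in> ts_K"
    using assms unfolding ts_H_def by blast
  have "tr_above s (ts_logx * b) = ts_logx * tr_above (s / ts_logx) b"
    using tr_above_of_mon_mult[of "abs_mon (Lg 1)" "s / ts_logx" b] of_mon_nonzero
    by (simp add: ell_def)
  then have "tr_above s F = tr_above s a + tr_above (s / ts_logx) b * ts_logx"
    unfolding F(1) linear_add[OF linear_tr_above] by (simp add: mult.commute)
  then show ?thesis unfolding ts_H_def using tr_above_in_ts_K F(2,3) by blast
qed

theorem proposition7p2:
  fixes s :: transseries
  assumes "0 < s"
  shows "linear (tr_above s) \<and> mono (tr_above s)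
    \<and> tr_above s ` ts_K \<subseteq> ts_K \<and> tr_above s ` ts_H \<subseteq> ts_H
    \<and> (\<forall>F. ts_bigo (F - tr_above s F) s)
    \<and> (\<forall>F F'. tr_above s F = tr_above s F' \<longleftrightarrow> ts_bigo (F - F') s)
    \<and> (\<forall>m F. s = of_mon m \<longrightarrow> ts_smallo (F - (tr_above s F + coeff F m *\<^sub>R s)) s)
    \<and> (\<forall>h F. tr_above (of_mon h * s) (of_mon h * F) = of_mon h * tr_above s F)"
proof -
  obtain d where d: "0 < coeff s d" "supp_le s d" using pos_leading_monomial[OF assms] .
  note tr = coeff_tr_above_leading[OF assms d]
  note bigo = bigo_iff_supp_le[OF assms d]
  have remainder: "ts_bigo (F - tr_above s F) s" for F
    by (simp add: bigo tr)
  have kernel: "tr_above s F = tr_above s F' \<longleftrightarrow> ts_bigo (F - F') s" for F F'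
  proof
    assume "tr_above s F = tr_above s F'"
    then have "coeff (tr_above s F) m = coeff (tr_above s F') m" for m by simp
    then show "ts_bigo (F - F') s" by (simp add: bigo tr) meson
  next
    assume "ts_bigo (F - F') s"
    then show "tr_above s F = tr_above s F'" by (intro ts_eqI) (simp add: bigo tr)
  qed
  have next_term: "ts_smallo (F - (tr_above s F + coeff F m *\<^sub>R s)) s" if "s = of_mon m" for m F
  proof -
    have s: "coeff s = single m" unfolding that by (rule coeff_of_mon)
    have m: "0 < coeff s m" "supp_le s m" unfolding s by (auto simp: single_def)
    show ?thesis
      by (rule smallo_if_supp_less[OF assms m])
         (auto simp: coeff_tr_above_leading[OF assms m] s single_def)
  qed
  show ?thesis
    using linear_tr_above mono_tr_above[OF assms] tr_above_in_ts_K tr_above_in_ts_H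
      remainder kernel next_term tr_above_of_mon_mult
    by blast
qed

end
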